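(* Let $\Omega$ be an infinite set, and let $f, g, h \in \mathrm{Inj}(\Omega)$ be any three maps that have support of cardinality $K$, where $\aleph_0 \leq K \leq |\Omega|$. Further, suppose that $|\Upsilon_f| = K = |\Upsilon_g|$. Then there exist permutations $a, b \in \mathrm{Sym}(\Omega)$ such that $h = afa^{-1}bgb^{-1}$ if and only if $|\Omega \setminus (\Omega)f| + |\Omega \setminus (\Omega)g| = |\Omega \setminus (\Omega)h|$.
   Context: $\mathrm{Inj}(\Omega)$ is the monoid of all injective maps $\Omega \to \Omega$, and $\mathrm{Sym}(\Omega)$ is the group of all permutations of $\Omega$. Maps are written on the right of their arguments, so $(\alpha)fg = ((\alpha)f)g$, and $(\Omega)f$ denotes the image of $f$. $|\cdot|$ denotes cardinality, and sums are sums of cardinals. The support of $f \in \mathrm{Inj}(\Omega)$ is the set $\{\alpha \in \Omega : (\alpha)f \neq \alpha\}$. For $f \in \mathrm{Inj}(\Omega)$, a nonempty set $\Sigma \subseteq \Omega$ is a cycle under $f$ if (i) for all $\alpha \in \Omega$, $(\alpha)f \in \Sigma$ if and only if $\alpha \in \Sigma$; and (ii) $\Sigma$ has no proper nonempty subset satisfying (i). An infinite cycle is a cycle that is an infinite set. For $f \in \mathrm{Inj}(\Omega)$, $\Upsilon_f \subseteq \Omega$ denotes the union of all the infinite cycles of $f$. *)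

theory Defs
  imports Main
begin

unbundle cardinal_syntax

text \<open>
  The set \<open>\<Omega>\<close> is rendered as the universe of a type \<open>'a\<close>.  Maps act on the right, so a product
  \<open>f g\<close> (first \<open>f\<close>, then \<open>g\<close>) is \<open>fcomp f g\<close>, for which the infix syntax \<open>f \<circ>> g\<close> is activated here.
\<close>
unbundle state_combinator_syntax

definition support :: "('a \<Rightarrow> 'a) \<Rightarrow> 'a set" where
  "support f = {\<alpha>. f \<alpha> \<noteq> \<alpha>}"

definition cycle_closed :: "('a \<Rightarrow> 'a) \<Rightarrow> 'a set \<Rightarrow> bool" where
  "cycle_closed f S \<longleftrightarrow> (\<forall>\<alpha>. f \<alpha> \<in> S \<longleftrightarrow> \<alpha> \<in> S)"

text \<open>Cycles may be infinite, in one direction (a forward orbit) or in both.\<close>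
definition is_cycle :: "('a \<Rightarrow> 'a) \<Rightarrow> 'a set \<Rightarrow> bool" where
  "is_cycle f S \<longleftrightarrow>
     S \<noteq> {} \<and> cycle_closed f S \<and> \<not> (\<exists>T. T \<subset> S \<and> T \<noteq> {} \<and> cycle_closed f T)"

definition Upsilon :: "('a \<Rightarrow> 'a) \<Rightarrow> 'a set" where
  "Upsilon f = \<Union>{S. is_cycle f S \<and> infinite S}"

end

theory Submission
  imports Defs "HOL-Library.Countable_Set"
begin

text \<open>
  Call \<open>|- range f|\<close> the defect of \<open>f\<close>.  Conjugation by a permutation keeps the defect, and for
  injective \<open>g\<close> the complement of \<open>range (g \<circ> f)\<close> is the disjoint union of \<open>- range g\<close> and
  \<open>g ` (- range f)\<close>.  So the defect is additive under products, which is the easy direction.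

  Conversely, let the defects add up.  The aim is a pair of permutations \<open>a\<close>, \<open>b\<close> such that
  \<open>a y = f (a x)\<close> always implies \<open>b (h x) = g (b y)\<close> (the predicate \<open>factors\<close>): then
  \<open>x \<mapsto> y\<close> is a conjugate \<open>f'\<close> of \<open>f\<close>, \<open>y \<mapsto> h x\<close> extends to a conjugate \<open>g'\<close> of \<open>g\<close>, and
  \<open>h = g' \<circ> f'\<close>.

  The first idea cuts the problem into countable pieces (\<open>factors_UNIV\<close>).  Bring the supports onto a
  common carrier \<open>M\<close> with \<open>K\<close> elements, and draw a graph on \<open>M\<close> that joins each point to its images
  under \<open>f\<close>, \<open>g\<close> and \<open>h\<close>, each point outside the range of \<open>f\<close> or of \<open>g\<close> to a partner outside the range
  of \<open>h\<close> (by a bijection that witnesses the equation of defects), and each point to a point on an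
  infinite cycle of \<open>f\<close>, to one on an infinite cycle of \<open>g\<close>, and to infinitely many points of the
  support of \<open>h\<close>.  All links are injective and there are countably many kinds of them, so the
  components are countable.  On each component all hypotheses hold again with \<open>\<aleph>\<^sub>0\<close> in place of
  \<open>K\<close>, and solutions on the components glue to a solution on everything; off \<open>M\<close> all three maps are
  the identity.

  The second idea solves the countable case (locale \<open>countable_construction\<close>).  One infinite cycle
  \<open>P\<close> of \<open>f\<close> and one infinite cycle \<open>Q\<close> of \<open>g\<close> are kept in reserve.  Since \<open>h\<close> moves infinitely many
  points, there are infinitely many points \<open>p\<^sub>i\<close> such that all the \<open>p\<^sub>i\<close> and \<open>h p\<^sub>i\<close> are distinct.
  On such points all of \<open>f\<close> outside \<open>P\<close> and all of \<open>g\<close> outside \<open>Q\<close> can be laid out at once: an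
  edge \<open>x \<mapsto> y\<close> of \<open>f'\<close> forces only the edge \<open>y \<mapsto> h x\<close> of \<open>g'\<close>, and the forced edges are
  pairwise disjoint.  What is left on either side is a collection of finite paths, which
  must be strung together to a single infinite cycle.  This is done by a back-and-forth argument: two
  paths of \<open>f'\<close>, or two paths of \<open>g'\<close>, can always be joined by way of a fresh point \<open>u\<close> or
  \<open>h u\<close> (\<open>bridge_E\<close>, \<open>bridge_G\<close>), and the edges that this adds on the other side only lengthen paths
  there and never close one up.  In the limit, \<open>f'\<close> consists of a copy of \<open>f\<close> outside \<open>P\<close> and of one
  more infinite cycle of the same shape as \<open>P\<close>, so it is conjugate to \<open>f\<close>; likewise for \<open>g'\<close>.
\<close>

section \<open>Infinite cycles as chains\<close>

text \<open>
  For injective \<open>f\<close> every infinite cycle has this form, which is easier to use than minimality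
  among the closed sets.
\<close>
definition infinite_chain :: "('a \<Rightarrow> 'a) \<Rightarrow> 'a set \<Rightarrow> bool" where
  "infinite_chain f P \<longleftrightarrow> infinite P \<and> cycle_closed f P \<and>
     (\<forall>x\<in>P. \<forall>y\<in>P. \<exists>n. (f ^^ n) x = y \<or> (f ^^ n) y = x)"

lemma funpow_cancel:
  fixes f :: "'a \<Rightarrow> 'a"
  assumes "inj f" and "(f ^^ (m + k)) x = (f ^^ m) y"
  shows "(f ^^ k) x = y"
proof -
  have "inj (f ^^ m)" using assms(1) by (induction m) (auto intro: inj_compose)
  then show ?thesis using assms(2) by (auto simp: funpow_add dest: injD)
qed

lemma cycle_closed_funpow: "cycle_closed f P \<Longrightarrow> (f ^^ n) x \<in> P \<longleftrightarrow> x \<in> P"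
  by (induction n) (auto simp: cycle_closed_def)

text \<open>
  A period \<open>k > 0\<close> at one point would leave only \<open>k\<close> points in the chain.
\<close>
lemma chain_aperiodic:
  assumes "inj f" and P: "infinite_chain f P" and x: "x \<in> P" and eq: "(f ^^ m) x = (f ^^ n) x"
  shows "m = n"
proof -
  have *: "k = 0" if k: "(f ^^ k) x = x" for k
  proof (rule ccontr)
    assume "k \<noteq> 0"
    have mul: "(f ^^ (k * j)) x = x" for j by (induction j) (auto simp: funpow_add k)
    have "P \<subseteq> (\<lambda>i. (f ^^ i) x) ` {..<k}"
    proof
      fix y assume "y \<in> P"
      then obtain i where "(f ^^ i) x = y \<or> (f ^^ i) y = x"
        using P x unfolding infinite_chain_def by blast
      \<comment> \<open>Periodicity turns a step backwards into a step forwards.\<close>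
      then obtain i where i: "(f ^^ i) x = y"
      proof
        assume i: "(f ^^ i) y = x"
        have "i \<le> k * i" using \<open>k \<noteq> 0\<close> by simp
        then have "(f ^^ (i + (k * i - i))) x = (f ^^ i) y" using mul[of i] i by simp
        then show ?thesis using that funpow_cancel[OF \<open>inj f\<close>] by blast
      qed
      have "(f ^^ (i mod k)) x = (f ^^ (i mod k + k * (i div k))) x"
        by (simp only: funpow_add o_apply mul)
      then have "(f ^^ (i mod k)) x = y" using i by simp
      then show "y \<in> (\<lambda>i. (f ^^ i) x) ` {..<k}" using \<open>k \<noteq> 0\<close> by force
    qed
    then show False using P finite_subset unfolding infinite_chain_def by blast
  qed
  show ?thesis
  proof (cases "m \<le> n")
    case True
    then have "(f ^^ (m + (n - m))) x = (f ^^ m) x" using eq by simp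
    from *[OF funpow_cancel[OF \<open>inj f\<close> this]] show ?thesis using True by simp
  next
    case False
    then have "(f ^^ (n + (m - n))) x = (f ^^ n) x" using eq by simp
    from *[OF funpow_cancel[OF \<open>inj f\<close> this]] show ?thesis using False by simp
  qed
qed

lemma chain_backward:
  assumes P: "infinite_chain f P" and sur: "\<forall>y\<in>P. y \<in> range f" and "y \<in> P"
  shows "\<exists>z\<in>P. (f ^^ n) z = y"
proof (induction n)
  case 0
  show ?case using \<open>y \<in> P\<close> by auto
next
  case (Suc n)
  then obtain z where z: "z \<in> P" "(f ^^ n) z = y" by blast
  then obtain w where "z = f w" using sur by blast
  moreover from this have "w \<in> P" using z P by (auto simp: infinite_chain_def cycle_closed_def)
  ultimately show ?case using z by (auto simp: funpow_swap1)
qed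

text \<open>
  The pair \<open>(m, n)\<close> records the position \<open>n - m\<close> of \<open>x\<close> relative to the base point \<open>x0\<close> without
  negative numbers.  The side condition on starts says that one can walk as far back in \<open>Q\<close> as in \<open>P\<close>.
\<close>
lemma chains_position:
  fixes f :: "'a \<Rightarrow> 'a" and f' :: "'b \<Rightarrow> 'b"
  assumes f': "infinite_chain f' Q" and P: "infinite_chain f P"
    and x0: "x0 \<in> P" and y0: "y0 \<in> Q"
    and start: "x0 \<notin> range f \<or> (\<forall>y\<in>Q. y \<in> range f')" and x: "x \<in> P"
  shows "\<exists>y\<in>Q. \<exists>m n. (f ^^ m) x = (f ^^ n) x0 \<and> (f' ^^ m) y = (f' ^^ n) y0"
proof -
  obtain n where "(f ^^ n) x0 = x \<or> (f ^^ n) x = x0"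
    using P x x0 unfolding infinite_chain_def by blast
  then show ?thesis
  proof
    assume "(f ^^ n) x0 = x"
    then have "(f ^^ 0) x = (f ^^ n) x0 \<and> (f' ^^ 0) ((f' ^^ n) y0) = (f' ^^ n) y0" by simp
    moreover have "(f' ^^ n) y0 \<in> Q"
      using f' y0 cycle_closed_funpow unfolding infinite_chain_def by metis
    ultimately show ?thesis by blast
  next
    assume n: "(f ^^ n) x = x0"
    have "\<exists>y\<in>Q. (f' ^^ n) y = y0"
    proof (cases "x0 \<in> range f")
      case True
      then show ?thesis using chain_backward[OF f'] start y0 by blast
    next
      case False
      then have "n = 0" using n by (cases n) auto
      then show ?thesis using y0 by simp
    qed
    then show ?thesis using n by (metis funpow_0)
  qed
qed

text \<open>
  Aperiodicity of \<open>P\<close> makes \<open>n - m\<close> a function of \<open>x\<close>, and injectivity of \<open>f'\<close> recovers the point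
  from its position.
\<close>
lemma position_unique:
  fixes f :: "'a \<Rightarrow> 'a" and f' :: "'b \<Rightarrow> 'b"
  assumes "inj f" "inj f'" and P: "infinite_chain f P" and x: "x0 \<in> P"
    and "(f ^^ m) x = (f ^^ n) x0" "(f' ^^ m) y = (f' ^^ n) y0"
    and "(f ^^ m') x = (f ^^ n') x0" "(f' ^^ m') y' = (f' ^^ n') y0"
  shows "y = y'"
proof -
  have "(f ^^ (m' + n)) x0 = (f ^^ (m + n')) x0"
  proof -
    have "(f ^^ (m' + n)) x0 = (f ^^ (m' + m)) x" using assms(5) by (simp add: funpow_add)
    also have "\<dots> = (f ^^ (m + m')) x" by (simp add: add.commute)
    also have "\<dots> = (f ^^ (m + n')) x0" using assms(7) by (simp add: funpow_add)
    finally show ?thesis .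
  qed
  then have eq: "m' + n = m + n'" using chain_aperiodic[OF assms(1) P x] by blast
  have "(f' ^^ (m' + m)) y = (f' ^^ (m' + n)) y0" using assms(6) by (simp add: funpow_add)
  also have "\<dots> = (f' ^^ (m + m')) y'" using assms(8) by (simp add: eq funpow_add)
  finally have "(f' ^^ (m' + m + 0)) y = (f' ^^ (m' + m)) y'" by (simp add: add.commute)
  from funpow_cancel[OF assms(2) this] show ?thesis by simp
qed

text \<open>
  Up to isomorphism there are only two infinite chains: the successor map on the integers and the one on
  the natural numbers.  They are told apart by whether some point has no preimage.
\<close>
lemma infinite_chains_conjugate:
  fixes f :: "'a \<Rightarrow> 'a" and f' :: "'b \<Rightarrow> 'b"
  assumes "inj f" "inj f'" and P: "infinite_chain f P" and Q: "infinite_chain f' Q"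
    and starts: "P \<subseteq> range f \<longleftrightarrow> Q \<subseteq> range f'"
  obtains \<theta> where "bij_betw \<theta> P Q" and "\<And>x. x \<in> P \<Longrightarrow> \<theta> (f x) = f' (\<theta> x)"
proof -
  have "P \<noteq> {}" "Q \<noteq> {}" using P Q by (auto simp: infinite_chain_def)
  obtain x0 where x0: "x0 \<in> P" "P \<subseteq> range f \<or> x0 \<notin> range f"
    using \<open>P \<noteq> {}\<close> by (metis subsetI all_not_in_conv)
  obtain y0 where y0: "y0 \<in> Q" "Q \<subseteq> range f' \<or> y0 \<notin> range f'"
    using \<open>Q \<noteq> {}\<close> by (metis subsetI all_not_in_conv)
  \<comment> \<open>Points at equal positions correspond.  The description is symmetric in the two chains.\<close>
  define \<Theta> where "\<Theta> x y \<longleftrightarrow> x \<in> P \<and> y \<in> Q \<and>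
    (\<exists>m n. (f ^^ m) x = (f ^^ n) x0 \<and> (f' ^^ m) y = (f' ^^ n) y0)" for x y
  have "x0 \<notin> range f \<or> (\<forall>y\<in>Q. y \<in> range f')" using x0 starts by blast
  then have tot: "\<exists>y. \<Theta> x y" if "x \<in> P" for x
    using chains_position[OF Q P x0(1) y0(1) _ that] that unfolding \<Theta>_def by blast
  have "y0 \<notin> range f' \<or> (\<forall>x\<in>P. x \<in> range f)" using y0 starts by blast
  then have sur: "\<exists>x. \<Theta> x y" if "y \<in> Q" for y
    using chains_position[OF P Q y0(1) x0(1) _ that] that unfolding \<Theta>_def by blast
  have uniq: "y = y'" if "\<Theta> x y" "\<Theta> x y'" for x y y'
    using that position_unique[OF \<open>inj f\<close> \<open>inj f'\<close> P x0(1)] unfolding \<Theta>_def by blast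
  have uniq': "x = x'" if "\<Theta> x y" "\<Theta> x' y" for x x' y
    using that position_unique[OF \<open>inj f'\<close> \<open>inj f\<close> Q y0(1)] unfolding \<Theta>_def by blast
  obtain \<theta> where \<theta>: "\<And>x. x \<in> P \<Longrightarrow> \<Theta> x (\<theta> x)" using tot by metis
  have "\<Theta> (f x) (f' y)" if "\<Theta> x y" for x y
  proof -
    from that obtain m n where "x \<in> P" "y \<in> Q" "(f ^^ m) x = (f ^^ n) x0" "(f' ^^ m) y = (f' ^^ n) y0"
      unfolding \<Theta>_def by blast
    then have "(f ^^ m) (f x) = (f ^^ Suc n) x0" "(f' ^^ m) (f' y) = (f' ^^ Suc n) y0"
      by (simp_all add: funpow_swap1[symmetric])
    moreover have "f x \<in> P" "f' y \<in> Q" using \<open>x \<in> P\<close> \<open>y \<in> Q\<close> P Q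
      by (simp_all add: infinite_chain_def cycle_closed_def)
    ultimately show ?thesis unfolding \<Theta>_def by blast
  qed
  then have "\<theta> (f x) = f' (\<theta> x)" if "x \<in> P" for x
    using \<theta> that uniq P unfolding infinite_chain_def cycle_closed_def by metis
  moreover have "bij_betw \<theta> P Q"
    unfolding bij_betw_def
  proof
    show "inj_on \<theta> P" by (rule inj_onI) (metis \<theta> uniq')
    show "\<theta> ` P = Q"
    proof
      show "\<theta> ` P \<subseteq> Q" using \<theta> unfolding \<Theta>_def by blast
      show "Q \<subseteq> \<theta> ` P"
      proof
        fix y assume "y \<in> Q"
        then obtain x where "\<Theta> x y" using sur by blast
        then show "y \<in> \<theta> ` P" using \<theta> uniq unfolding \<Theta>_def by blast
      qed
    qed
  qed
  ultimately show ?thesis using that by blast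
qed

text \<open>
  The recognition principle for the limit of the construction: a map that contains a copy of \<open>f\<close>
  outside \<open>P\<close> and otherwise consists of a single chain shaped like \<open>P\<close> is conjugate to \<open>f\<close>.
\<close>
lemma conjugate_if_one_chain_remains:
  fixes f :: "'a \<Rightarrow> 'a" and f' :: "'b \<Rightarrow> 'b"
  assumes "inj f" "inj f'" and P: "infinite_chain f P" and Q: "infinite_chain f' (- X)"
    and \<phi>: "bij_betw \<phi> (- P) X" "\<And>x. x \<notin> P \<Longrightarrow> f' (\<phi> x) = \<phi> (f x)"
    and starts: "P \<subseteq> range f \<longleftrightarrow> - X \<subseteq> range f'"
  obtains a where "bij a" and "\<And>x. a (f' x) = f (a x)"
proof -
  obtain \<theta> where \<theta>: "bij_betw \<theta> P (- X)" "\<And>x. x \<in> P \<Longrightarrow> \<theta> (f x) = f' (\<theta> x)"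
    using infinite_chains_conjugate[OF assms(1-4) starts] by blast
  define c where "c x = (if x \<in> P then \<theta> x else \<phi> x)" for x
  have "bij_betw c P (- X)" using \<theta>(1) by (subst bij_betw_cong[where g=\<theta>]) (auto simp: c_def)
  moreover have "bij_betw c (- P) X" using \<phi>(1) by (subst bij_betw_cong[where g=\<phi>]) (auto simp: c_def)
  ultimately have "bij_betw c (P \<union> - P) (- X \<union> X)" by (rule bij_betw_combine) auto
  then have "bij c" by (simp add: Compl_partition Compl_partition2)
  have "c (f x) = f' (c x)" for x
    using \<theta>(2) \<phi>(2) P by (auto simp: c_def infinite_chain_def cycle_closed_def)
  then have "inv c (f' y) = f (inv c y)" for y
    by (metis \<open>bij c\<close> bij_inv_eq_iff)
  then show ?thesis using that bij_imp_bij_inv[OF \<open>bij c\<close>] by blast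
qed

lemma chain_start_unique:
  assumes R: "infinite_chain k R" "s \<in> R" "t \<in> R" "s \<notin> range k" "t \<notin> range k"
  shows "s = t"
proof -
  obtain n where "(k ^^ n) s = t \<or> (k ^^ n) t = s" using R unfolding infinite_chain_def by blast
  then show ?thesis using R by (cases n) auto
qed

lemma is_cycle_minimal:
  assumes "is_cycle f S" "cycle_closed f T" "T \<subseteq> S" "T \<noteq> {}"
  shows "T = S"
  using assms unfolding is_cycle_def by (metis psubsetI)

text \<open>
  The points of \<open>S\<close> whose forward orbit meets the forward orbit of \<open>x\<close> form a closed set, so
  they are all of \<open>S\<close>.
\<close>
lemma is_cycle_imp_infinite_chain:
  fixes f :: "'a \<Rightarrow> 'a"
  assumes "inj f" and S: "is_cycle f S" "infinite S"
  shows "infinite_chain f S"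
  unfolding infinite_chain_def
proof (intro conjI ballI)
  show "infinite S" by (fact S)
  show closed: "cycle_closed f S" using S by (simp add: is_cycle_def)
next
  fix x y assume "x \<in> S" "y \<in> S"
  have closed: "cycle_closed f S" using S by (simp add: is_cycle_def)
  let ?T = "{y \<in> S. \<exists>m n. (f ^^ m) x = (f ^^ n) y}"
  have "cycle_closed f ?T"
    unfolding cycle_closed_def
  proof (intro allI iffI)
    fix z assume "f z \<in> ?T"
    then obtain m n where "(f ^^ m) x = (f ^^ n) (f z)" "z \<in> S"
      using closed by (auto simp: cycle_closed_def)
    then have "(f ^^ m) x = (f ^^ Suc n) z" by (simp add: funpow_swap1)
    then show "z \<in> ?T" using \<open>z \<in> S\<close> by blast
  next
    fix z assume "z \<in> ?T"
    then obtain m n where "(f ^^ m) x = (f ^^ n) z" "z \<in> S" by blast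
    then have "(f ^^ Suc m) x = (f ^^ n) (f z)" "f z \<in> S"
      using closed by (simp_all add: funpow_swap1 cycle_closed_def)
    then show "f z \<in> ?T" by blast
  qed
  moreover have "x \<in> ?T" using \<open>x \<in> S\<close> by blast
  then have "?T \<noteq> {}" by (metis empty_iff)
  ultimately have "?T = S" using is_cycle_minimal[OF S(1), of ?T] by simp
  then have "y \<in> ?T" using \<open>y \<in> S\<close> by simp
  then obtain m n where mn: "(f ^^ m) x = (f ^^ n) y" by auto
  show "\<exists>n. (f ^^ n) x = y \<or> (f ^^ n) y = x"
  proof (cases "m \<le> n")
    case True
    then have "(f ^^ (m + (n - m))) y = (f ^^ m) x" using mn by simp
    then show ?thesis using funpow_cancel[OF \<open>inj f\<close>] by blast
  next
    case False
    then have "(f ^^ (n + (m - n))) x = (f ^^ n) y" using mn by simp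
    then show ?thesis using funpow_cancel[OF \<open>inj f\<close>] by blast
  qed
qed

text \<open>
  A closed set that meets a cycle contains it, by minimality of the cycle.
\<close>
lemma Upsilon_closed_chain:
  assumes "inj f" and A: "cycle_closed f A" and z: "z \<in> Upsilon f" "z \<in> A"
  obtains P where "infinite_chain f P" "P \<subseteq> A"
proof -
  obtain S where S: "is_cycle f S" "infinite S" "z \<in> S" using z(1) unfolding Upsilon_def by blast
  have "cycle_closed f (S \<inter> A)" using S(1) A by (simp add: is_cycle_def cycle_closed_def)
  then have "S \<inter> A = S" using is_cycle_minimal[OF S(1)] S(3) z(2) by blast
  then show ?thesis using that is_cycle_imp_infinite_chain[OF \<open>inj f\<close> S(1,2)] by blast
qed

text \<open>
  The last hypothesis excludes that an orbit of \<open>k\<close> enters the copy from outside, at the image of a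
  point that has no preimage under \<open>f\<close>.
\<close>
lemma conjugated_image_closed:
  assumes "inj k" and "\<And>\<alpha>. \<alpha> \<notin> P \<Longrightarrow> k (\<theta> \<alpha>) = \<theta> (f \<alpha>)" and "\<And>\<alpha>. f \<alpha> \<in> P \<longleftrightarrow> \<alpha> \<in> P"
    and "\<And>\<alpha>. \<theta> \<alpha> \<in> range k \<Longrightarrow> \<alpha> \<in> range f"
  shows "k x \<in> \<theta> ` (- P) \<longleftrightarrow> x \<in> \<theta> ` (- P)"
proof
  assume "k x \<in> \<theta> ` (- P)"
  then obtain \<alpha> where \<alpha>: "\<alpha> \<notin> P" "k x = \<theta> \<alpha>" by auto
  then obtain \<gamma> where \<gamma>: "\<alpha> = f \<gamma>" using assms(4)[of \<alpha>] by (metis rangeE rangeI)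
  then have "\<gamma> \<notin> P" using \<alpha>(1) assms(3) by simp
  then have "k x = k (\<theta> \<gamma>)" using assms(2) \<alpha>(2) \<gamma> by simp
  then have "x = \<theta> \<gamma>" using \<open>inj k\<close> by (simp add: inj_eq)
  then show "x \<in> \<theta> ` (- P)" using \<open>\<gamma> \<notin> P\<close> by simp
next
  assume "x \<in> \<theta> ` (- P)"
  then show "k x \<in> \<theta> ` (- P)" using assms(2,3) by auto
qed

section \<open>Relations whose components are finite paths\<close>

text \<open>
  The graph of a partial injection in which every point off \<open>X\<close> lies on a finite path, with a last point
  \<open>e\<close> and a first point \<open>b\<close>.  A single point counts as a path.  The set \<open>X\<close> carries the part of the map
  that is already complete.
\<close>
definition finite_paths :: "('a \<times> 'a) set \<Rightarrow> 'a set \<Rightarrow> bool" where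
  "finite_paths R X \<longleftrightarrow> single_valued R \<and> single_valued (R\<inverse>) \<and>
     (\<forall>x. x \<notin> X \<longrightarrow> (\<exists>e. (x, e) \<in> R\<^sup>* \<and> e \<notin> Domain R) \<and> (\<exists>b. (b, x) \<in> R\<^sup>* \<and> b \<notin> Range R))"

definition linked :: "('a \<times> 'a) set \<Rightarrow> 'a \<Rightarrow> 'a \<Rightarrow> bool" where
  "linked R x y \<longleftrightarrow> (x, y) \<in> R\<^sup>* \<or> (y, x) \<in> R\<^sup>*"

lemma linked_mono: "linked R x y \<Longrightarrow> R \<subseteq> R' \<Longrightarrow> linked R' x y"
  unfolding linked_def by (meson rtrancl_mono subsetD)

lemma linked_sym: "linked R x y \<Longrightarrow> linked R y x"
  unfolding linked_def by blast

text \<open>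
  A path that used to end in \<open>e\<close> now ends where the path of \<open>b\<close> ends.  This is a point other
  than \<open>e\<close>, as \<open>e\<close> is not reachable from \<open>b\<close>.
\<close>
lemma insert_edge_ends:
  assumes R: "\<forall>x. x \<notin> X \<longrightarrow> (\<exists>e. (x, e) \<in> R\<^sup>* \<and> e \<notin> Domain R)"
    and "b \<notin> X" "(b, e) \<notin> R\<^sup>*" "x \<notin> X"
  shows "\<exists>e'. (x, e') \<in> (insert (e, b) R)\<^sup>* \<and> e' \<notin> Domain (insert (e, b) R)"
proof -
  have mono: "R\<^sup>* \<subseteq> (insert (e, b) R)\<^sup>*" by (rule rtrancl_mono) blast
  obtain e1 where e1: "(x, e1) \<in> R\<^sup>*" "e1 \<notin> Domain R" using R assms(4) by blast
  show ?thesis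
  proof (cases "e1 = e")
    case True
    obtain e2 where e2: "(b, e2) \<in> R\<^sup>*" "e2 \<notin> Domain R" using R assms(2) by blast
    have "(x, e2) \<in> (insert (e, b) R)\<^sup>*"
      using e1(1) e2(1) mono True
      by (meson insertI1 rtrancl.rtrancl_into_rtrancl rtrancl_trans subsetD)
    moreover have "e2 \<noteq> e" using e2 assms(3) by blast
    ultimately show ?thesis using e2 by auto
  next
    case False
    then show ?thesis using e1 mono by blast
  qed
qed

text \<open>
  Beginnings are the ends of the converse relation, so one half of the argument serves for both.
\<close>
lemma finite_paths_insert:
  assumes R: "finite_paths R X" and "e \<notin> Domain R" "b \<notin> Range R" "e \<notin> X" "b \<notin> X" "(b, e) \<notin> R\<^sup>*"
  shows "finite_paths (insert (e, b) R) X"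
proof -
  have "\<exists>b'. (b', x) \<in> (insert (e, b) R)\<^sup>* \<and> b' \<notin> Range (insert (e, b) R)" if "x \<notin> X" for x
  proof -
    have "\<forall>x. x \<notin> X \<longrightarrow> (\<exists>e. (x, e) \<in> (R\<inverse>)\<^sup>* \<and> e \<notin> Domain (R\<inverse>))"
      using R by (simp add: finite_paths_def rtrancl_converse)
    moreover have "(e, b) \<notin> (R\<inverse>)\<^sup>*" using assms(6) by (simp add: rtrancl_converse)
    ultimately have "\<exists>b'. (x, b') \<in> (insert (b, e) (R\<inverse>))\<^sup>* \<and> b' \<notin> Domain (insert (b, e) (R\<inverse>))"
      using insert_edge_ends[of X "R\<inverse>" e b x] assms(4) that by blast
    moreover have "insert (b, e) (R\<inverse>) = (insert (e, b) R)\<inverse>" by auto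
    ultimately show ?thesis by (simp add: rtrancl_converse)
  qed
  moreover have "\<exists>e'. (x, e') \<in> (insert (e, b) R)\<^sup>* \<and> e' \<notin> Domain (insert (e, b) R)" if "x \<notin> X" for x
    using insert_edge_ends[of X R b e x] R assms(5,6) that by (simp add: finite_paths_def)
  moreover have "single_valued (insert (e, b) R)" "single_valued ((insert (e, b) R)\<inverse>)"
    using R assms(2,3) by (auto simp: finite_paths_def single_valued_def)
  ultimately show ?thesis unfolding finite_paths_def by blast
qed

text \<open>
  Paths cannot branch or merge, so a path from the beginning \<open>b\<close> of \<open>y\<close> to the end \<open>e\<close> of \<open>x\<close> would
  contain both \<open>x\<close> and \<open>y\<close>.  This is what guarantees that an edge from \<open>e\<close> to \<open>b\<close> closes no cycle.
\<close>
lemma end_unreachable_if_not_linked: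
  assumes R: "finite_paths R X" and e: "(x, e) \<in> R\<^sup>*" "e \<notin> Domain R"
    and b: "(b, y) \<in> R\<^sup>*" and "\<not> linked R x y"
  shows "(b, e) \<notin> R\<^sup>*"
proof
  assume "(b, e) \<in> R\<^sup>*"
  then have "(y, e) \<in> R\<^sup>* \<or> (e, y) \<in> R\<^sup>*"
    using single_valued_confluent b R unfolding finite_paths_def by metis
  then have "(y, e) \<in> R\<^sup>*" using e(2) by (auto elim: converse_rtranclE)
  moreover have "single_valued (R\<inverse>)" using R by (simp add: finite_paths_def)
  ultimately have "(x, y) \<in> (R\<inverse>)\<^sup>* \<or> (y, x) \<in> (R\<inverse>)\<^sup>*"
    using single_valued_confluent[of "R\<inverse>" e x y] e(1) by (simp add: rtrancl_converse)
  then show False using assms(5) by (auto simp: linked_def rtrancl_converse)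
qed

lemma rtrancl_from_end: "(x, y) \<in> R\<^sup>* \<Longrightarrow> x \<notin> Domain R \<Longrightarrow> x = y"
  by (auto elim: converse_rtranclE)

lemma rtrancl_to_beginning: "(x, y) \<in> R\<^sup>* \<Longrightarrow> y \<notin> Range R \<Longrightarrow> x = y"
  by (auto elim: rtranclE)

text \<open>
  The new edge is the only one that enters \<open>u\<close>.
\<close>
lemma rtrancl_insert_to_fresh:
  assumes "(x, u) \<in> (insert (e, u) R)\<^sup>*" and "u \<notin> Range R" "x \<noteq> u"
  shows "(x, e) \<in> R\<^sup>*"
proof -
  have "(x, u) \<notin> R\<^sup>*" using rtrancl_to_beginning[of x u R] assms(2,3) by blast
  then show ?thesis using assms(1) by (simp add: rtrancl_insert)
qed

text \<open>
  Off \<open>X'\<close> no two edges meet, so that paths have length at most one; this is the state before any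
  bridge is built.
\<close>
lemma finite_pathsI_disjoint_edges:
  assumes "single_valued R" "single_valued (R\<inverse>)"
    and "\<And>x y. (x, y) \<in> R \<Longrightarrow> x \<notin> X' \<Longrightarrow> y \<notin> Domain R"
    and "\<And>x y. (x, y) \<in> R \<Longrightarrow> y \<notin> X' \<Longrightarrow> x \<notin> Range R"
  shows "finite_paths R X'"
  unfolding finite_paths_def
proof (intro conjI allI impI assms(1,2))
  fix x assume x: "x \<notin> X'"
  show "\<exists>e. (x, e) \<in> R\<^sup>* \<and> e \<notin> Domain R"
    using x assms(3) by (cases "x \<in> Domain R") blast+
  show "\<exists>b. (b, x) \<in> R\<^sup>* \<and> b \<notin> Range R"
    using x assms(4) by (cases "x \<in> Range R") blast+
qed

lemma rtrancl_stays:
  assumes "single_valued R" and "\<And>u. u \<in> Z \<Longrightarrow> \<exists>v\<in>Z. (u, v) \<in> R"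
    and "(u, v) \<in> R\<^sup>*" "u \<in> Z"
  shows "v \<in> Z"
  using assms(3,4)
proof (induction rule: rtrancl_induct)
  case (step v w)
  then show ?case using assms(1,2) by (metis single_valuedD)
qed

lemma finite_paths_ends:
  assumes "finite_paths R Z" "x \<notin> Z"
  obtains e b where "(x, e) \<in> R\<^sup>*" "e \<notin> Domain R" "(b, x) \<in> R\<^sup>*" "b \<notin> Range R"
  using assms unfolding finite_paths_def by metis

lemma distinct_beginnings:
  assumes "finite_paths R Z" "\<not> linked R x y" "(b, x) \<in> R\<^sup>*" "(b', y) \<in> R\<^sup>*"
  shows "b \<noteq> b'"
  using assms single_valued_confluent[of R b x y] unfolding linked_def finite_paths_def by metis

lemma link_by_edges:
  assumes "(x, e) \<in> R\<^sup>*" "(b, y) \<in> R\<^sup>*" "R \<subseteq> R'" "(e, u) \<in> R'" "(u, b) \<in> R'"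
  shows "linked R' x y"
proof -
  have "(x, e) \<in> R'\<^sup>*" "(b, y) \<in> R'\<^sup>*" using rtrancl_mono[OF assms(3)] assms(1,2) by blast+
  then show ?thesis unfolding linked_def
    using assms(4,5) by (meson rtrancl.rtrancl_into_rtrancl rtrancl_trans)
qed

lemma rtrancl_graph: "(x, y) \<in> {(x, k x) |x. True}\<^sup>* \<Longrightarrow> \<exists>n. (k ^^ n) x = y"
proof (induction rule: rtrancl_induct)
  case base
  show ?case by (metis funpow_0)
next
  case (step y z)
  then obtain n where "(k ^^ n) x = y" "z = k y" by auto
  then have "(k ^^ Suc n) x = z" by simp
  then show ?case by blast
qed

section \<open>The countable construction\<close>

text \<open>
  The set-theoretic form of the back-and-forth method: countably many requirements, each of which can be
  met by enlarging any admissible set, are met along an increasing sequence.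
\<close>
lemma generic_chain:
  fixes A :: "'a set" and D :: "nat \<Rightarrow> 'a set \<Rightarrow> bool"
  assumes "I A" and "\<And>k E. I E \<Longrightarrow> \<exists>E'. E \<subseteq> E' \<and> I E' \<and> D k E'"
  obtains E where "\<And>n. I (E n)" "\<And>n. E n \<subseteq> E (Suc n)" "\<And>n. D n (E (Suc n))" "E 0 = A"
proof -
  have "\<exists>E. \<forall>n. (I (E n) \<and> (n = 0 \<longrightarrow> E n = A)) \<and> (E n \<subseteq> E (Suc n) \<and> D n (E (Suc n)))"
  proof (rule dependent_nat_choice)
    fix E and n :: nat assume "I E \<and> (n = 0 \<longrightarrow> E = A)"
    then show "\<exists>E'. (I E' \<and> (Suc n = 0 \<longrightarrow> E' = A)) \<and> E \<subseteq> E' \<and> D n E'"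
      using assms(2)[of E n] by blast
  qed (use assms(1) in auto)
  then show ?thesis using that by blast
qed

text \<open>
  The images of \<open>\<sigma>\<close> and \<open>\<tau>\<close> split the complement of \<open>range h\<close>.  In a factorisation \<open>h = g' \<circ> f'\<close>
  a point outside \<open>range h\<close> is either outside \<open>range g'\<close> or the value of \<open>g'\<close> at a point outside
  \<open>range f'\<close>.  The map \<open>\<tau>\<close> decides which points are of the first sort, \<open>\<sigma>\<close> which are of the second.
  The points \<open>p i\<close> are taken in \<open>range h\<close> so that they stay clear of both.
\<close>
locale countable_construction =
  fixes f g h :: "nat \<Rightarrow> nat" and P Q :: "nat set" and \<sigma> \<tau> p :: "nat \<Rightarrow> nat"
  assumes inj_f: "inj f" and inj_g: "inj g" and inj_h: "inj h"
    and P: "infinite_chain f P" and Q: "infinite_chain g Q"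
    and inj_\<sigma>: "inj_on \<sigma> (- range f)" and inj_\<tau>: "inj_on \<tau> (- range g)"
    and disj: "\<sigma> ` (- range f) \<inter> \<tau> ` (- range g) = {}"
    and cover: "\<sigma> ` (- range f) \<union> \<tau> ` (- range g) = - range h"
    and inj_p: "inj p" and p_range: "\<And>i. p i \<in> range h" and p_indep: "\<And>i j. p i \<noteq> h (p j)"
begin

text \<open>
  The points \<open>p i\<close> are divided into three families.  The values of \<open>\<phi>\<close> carry the copy of \<open>f\<close>, those of \<open>h \<circ> q\<close>
  the copy of \<open>g\<close>, and those of \<open>r\<close> are the supply for bridges.  The copy \<open>\<psi>\<close> of \<open>g\<close> must send the points
  outside \<open>range g\<close> to the points that \<open>\<tau>\<close> reserves for them.
\<close>
definition \<phi> :: "nat \<Rightarrow> nat" where "\<phi> \<alpha> = p (3 * \<alpha>)"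
definition q :: "nat \<Rightarrow> nat" where "q \<beta> = p (3 * \<beta> + 1)"
definition \<psi> :: "nat \<Rightarrow> nat" where "\<psi> \<beta> = (if \<beta> \<in> range g then h (q \<beta>) else \<tau> \<beta>)"
definition r :: "nat \<Rightarrow> nat" where "r i = p (3 * i + 2)"

text \<open>
  \<open>S\<close> is the intended complement of the range of \<open>f'\<close>.  On \<open>X\<close> the map \<open>f'\<close> is complete from the beginning, on
  \<open>Y\<close> the map \<open>g'\<close>.
\<close>
abbreviation S :: "nat set" where "S \<equiv> \<phi> ` (- range f)"
abbreviation X :: "nat set" where "X \<equiv> \<phi> ` (- P)"
abbreviation Y :: "nat set" where "Y \<equiv> \<psi> ` (- Q)"

text \<open>
  \<open>E\<close> always stands for a part of the graph of \<open>f'\<close>.  The initial part consists of the copy under \<open>\<phi>\<close>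
  of \<open>f\<close> outside \<open>P\<close>, and of the edges that are forced by the copy under \<open>\<psi>\<close> of \<open>g\<close> outside
  \<open>Q\<close>: as \<open>\<psi> (g \<beta>) = h (q (g \<beta>))\<close>, the edge from \<open>\<psi> \<beta>\<close> to \<open>\<psi> (g \<beta>)\<close> of \<open>g'\<close> arises from the edge from
  \<open>q (g \<beta>)\<close> to \<open>\<psi> \<beta>\<close> of \<open>f'\<close>.
\<close>
definition E0 :: "(nat \<times> nat) set" where
  "E0 = {(\<phi> \<alpha>, \<phi> (f \<alpha>)) |\<alpha>. \<alpha> \<notin> P} \<union> {(q (g \<beta>), \<psi> \<beta>) |\<beta>. \<beta> \<notin> Q}"

text \<open>
  The part of the graph of \<open>g'\<close> that \<open>E\<close> forces.  The points of \<open>S\<close> will be those outside the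
  range of \<open>f'\<close>, and \<open>g'\<close> maps them to the points outside \<open>range h\<close> that \<open>\<sigma>\<close> selects.
\<close>
definition G :: "(nat \<times> nat) set \<Rightarrow> (nat \<times> nat) set" where
  "G E = {(y, h x) |x y. (x, y) \<in> E} \<union> {(\<phi> \<alpha>, \<sigma> \<alpha>) |\<alpha>. \<alpha> \<notin> range f}"

lemma p_eq [simp]: "p i = p j \<longleftrightarrow> i = j" using inj_p by (auto dest: injD)
lemma h_eq [simp]: "h x = h y \<longleftrightarrow> x = y" using inj_h by (auto dest: injD)
lemma f_eq [simp]: "f x = f y \<longleftrightarrow> x = y" using inj_f by (auto dest: injD)
lemma g_eq [simp]: "g x = g y \<longleftrightarrow> x = y" using inj_g by (auto dest: injD)
lemma f_P [simp]: "f x \<in> P \<longleftrightarrow> x \<in> P" using P by (simp add: infinite_chain_def cycle_closed_def)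
lemma g_Q [simp]: "g x \<in> Q \<longleftrightarrow> x \<in> Q" using Q by (simp add: infinite_chain_def cycle_closed_def)

lemma \<phi>_eq [simp]: "\<phi> x = \<phi> y \<longleftrightarrow> x = y" by (simp add: \<phi>_def)
lemma q_eq [simp]: "q x = q y \<longleftrightarrow> x = y" by (simp add: q_def)
lemma r_eq [simp]: "r x = r y \<longleftrightarrow> x = y" by (simp add: r_def)
lemma families_distinct [simp]:
  "\<phi> x \<noteq> q y" "q y \<noteq> \<phi> x" "\<phi> x \<noteq> r y" "r y \<noteq> \<phi> x" "q x \<noteq> r y" "r y \<noteq> q x"
  unfolding \<phi>_def q_def r_def p_eq by presburger+
lemma families_independent [simp]:
  "\<phi> x \<noteq> h (\<phi> y)" "\<phi> x \<noteq> h (q y)" "\<phi> x \<noteq> h (r y)"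
  "q x \<noteq> h (\<phi> y)" "q x \<noteq> h (q y)" "q x \<noteq> h (r y)"
  "r x \<noteq> h (\<phi> y)" "r x \<noteq> h (q y)" "r x \<noteq> h (r y)"
  "h (\<phi> y) \<noteq> \<phi> x" "h (q y) \<noteq> \<phi> x" "h (r y) \<noteq> \<phi> x"
  "h (\<phi> y) \<noteq> q x" "h (q y) \<noteq> q x" "h (r y) \<noteq> q x"
  "h (\<phi> y) \<noteq> r x" "h (q y) \<noteq> r x" "h (r y) \<noteq> r x"
  by (simp_all add: \<phi>_def q_def r_def p_indep p_indep[THEN not_sym])
lemma \<sigma>_notin: "\<alpha> \<notin> range f \<Longrightarrow> \<sigma> \<alpha> \<notin> range h" using cover by blast
lemma \<tau>_notin: "\<beta> \<notin> range g \<Longrightarrow> \<tau> \<beta> \<notin> range h" using cover by blast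
lemma \<sigma>_neq [simp]:
  assumes "\<alpha> \<notin> range f"
  shows "\<sigma> \<alpha> \<noteq> h x" "h x \<noteq> \<sigma> \<alpha>" "\<sigma> \<alpha> \<noteq> \<phi> y" "\<phi> y \<noteq> \<sigma> \<alpha>" "\<sigma> \<alpha> \<noteq> q y" "q y \<noteq> \<sigma> \<alpha>" "\<sigma> \<alpha> \<noteq> r y" "r y \<noteq> \<sigma> \<alpha>"
  using \<sigma>_notin[OF assms] p_range unfolding \<phi>_def q_def r_def by (metis rangeI)+
lemma \<tau>_neq:
  assumes "\<alpha> \<notin> range g"
  shows "\<tau> \<alpha> \<noteq> h x" "\<tau> \<alpha> \<noteq> \<phi> y" "\<tau> \<alpha> \<noteq> q y" "\<tau> \<alpha> \<noteq> r y"
  using \<tau>_notin[OF assms] p_range unfolding \<phi>_def q_def r_def by (metis rangeI)+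
lemma \<psi>_neq [simp]:
  "\<psi> x \<noteq> \<phi> y" "\<phi> y \<noteq> \<psi> x" "\<psi> x \<noteq> q y" "q y \<noteq> \<psi> x" "\<psi> x \<noteq> r y" "r y \<noteq> \<psi> x"
  "\<psi> x \<noteq> h (\<phi> y)" "h (\<phi> y) \<noteq> \<psi> x" "\<psi> x \<noteq> h (r y)" "h (r y) \<noteq> \<psi> x"
  using \<tau>_neq[of x] unfolding \<psi>_def by (simp_all split: if_split) metis+
lemma \<sigma>_\<psi> [simp]: "\<alpha> \<notin> range f \<Longrightarrow> \<sigma> \<alpha> \<noteq> \<psi> \<beta>" "\<alpha> \<notin> range f \<Longrightarrow> \<psi> \<beta> \<noteq> \<sigma> \<alpha>"
  using disj unfolding \<psi>_def by auto
lemma \<psi>_g [simp]: "\<psi> (g \<beta>) = h (q (g \<beta>))" by (simp add: \<psi>_def)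
lemma \<psi>_eq [simp]: "\<psi> x = \<psi> y \<longleftrightarrow> x = y"
  using inj_on_eq_iff[OF inj_\<tau>, of x y] \<tau>_neq(1)[of x "q y"] \<tau>_neq(1)[of y "q x"]
  by (simp add: \<psi>_def) metis

lemma G_insert: "G (insert (e, b) E) = insert (b, h e) (G E)"
  unfolding G_def by auto

lemma G_mono: "E \<subseteq> E' \<Longrightarrow> G E \<subseteq> G E'"
  unfolding G_def by auto

lemma Domain_G: "Domain (G E) = Range E \<union> S"
  unfolding G_def by auto

lemma Range_G: "z \<in> Range (G E) \<longleftrightarrow> z \<in> h ` Domain E \<or> z \<in> \<sigma> ` (- range f)"
  unfolding G_def by auto

lemma G_E0: "G E0 = {(\<phi> (f \<alpha>), h (\<phi> \<alpha>)) |\<alpha>. \<alpha> \<notin> P} \<union> {(\<psi> \<beta>, \<psi> (g \<beta>)) |\<beta>. \<beta> \<notin> Q}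
    \<union> {(\<phi> \<alpha>, \<sigma> \<alpha>) |\<alpha>. \<alpha> \<notin> range f}"
  unfolding G_def E0_def \<psi>_g by blast

text \<open>
  Finiteness of \<open>E - E0\<close> keeps the supply \<open>r\<close> of unused points from running out.
\<close>
definition admissible :: "(nat \<times> nat) set \<Rightarrow> bool" where
  "admissible E \<longleftrightarrow> E0 \<subseteq> E \<and> finite (E - E0) \<and> Range E \<inter> S = {} \<and>
     finite_paths E X \<and> finite_paths (G E) Y"

lemma finite_paths_E0: "finite_paths E0 X"
proof (rule finite_pathsI_disjoint_edges)
  show "single_valued E0" "single_valued (E0\<inverse>)"
    by (auto simp: single_valued_def E0_def)
qed (auto simp: E0_def)

lemma finite_paths_G_E0: "finite_paths (G E0) Y"
proof (rule finite_pathsI_disjoint_edges)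
  show "single_valued (G E0)"
    by (auto simp: single_valued_def G_E0 simp del: \<psi>_g)
  show "single_valued ((G E0)\<inverse>)"
    using inj_onD[OF inj_\<sigma>] by (auto simp: single_valued_def G_E0 simp del: \<psi>_g)
qed (auto simp: G_E0 simp del: \<psi>_g)

lemma admissible_E0: "admissible E0"
  unfolding admissible_def using finite_paths_E0 finite_paths_G_E0 by (auto simp: E0_def)

lemma r_isolated_E0:
  "r i \<notin> Field E0" "h (r i) \<notin> Field E0" "r i \<notin> Field (G E0)" "h (r i) \<notin> Field (G E0)"
  unfolding G_E0 unfolding E0_def by (auto simp: Field_def simp del: \<psi>_g)

text \<open>
  A fresh point \<open>u\<close> together with \<open>h u\<close> can serve to build a bridge: both are isolated on the \<open>f'\<close> side and
  on the \<open>g'\<close> side.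
\<close>
definition fresh :: "(nat \<times> nat) set \<Rightarrow> nat \<Rightarrow> bool" where
  "fresh E u \<longleftrightarrow> u \<notin> Field E \<and> h u \<notin> Field E \<and> u \<notin> Field (G E) \<and> h u \<notin> Field (G E) \<and>
     u \<notin> S \<and> h u \<notin> S \<and> h u \<noteq> u"

lemma fresh_point:
  assumes E: "admissible E" and "finite F"
  obtains u where "fresh E u" "u \<notin> F" "h u \<notin> F"
proof -
  let ?N = "E - E0"
  let ?B = "Field ?N \<union> Field {(y, h x) |x y. (x, y) \<in> ?N} \<union> F"
  have "{(y, h x) |x y. (x, y) \<in> ?N} = (\<lambda>(x, y). (y, h x)) ` ?N" by auto
  then have "finite ?B" using E \<open>finite F\<close> by (simp add: admissible_def finite_Field)
  moreover have "inj r" "inj (h \<circ> r)" by (auto simp: inj_def)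
  ultimately have "finite (r -` ?B \<union> (h \<circ> r) -` ?B)"
    using finite_vimageI[of ?B r] finite_vimageI[of ?B "h \<circ> r"] by blast
  then obtain i where "i \<notin> r -` ?B \<union> (h \<circ> r) -` ?B" using ex_new_if_finite infinite_UNIV_nat by blast
  then have i: "r i \<notin> ?B" "h (r i) \<notin> ?B" by simp_all
  have "E \<subseteq> E0 \<union> ?N" by blast
  moreover have "G E \<subseteq> G E0 \<union> {(y, h x) |x y. (x, y) \<in> ?N}" unfolding G_def by blast
  ultimately have "Field E \<subseteq> Field E0 \<union> Field ?N"
    "Field (G E) \<subseteq> Field (G E0) \<union> Field {(y, h x) |x y. (x, y) \<in> ?N}"
    using mono_Field unfolding Field_Un[symmetric] by blast+
  then have "r i \<notin> Field E" "h (r i) \<notin> Field E" "r i \<notin> Field (G E)" "h (r i) \<notin> Field (G E)"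
    using i r_isolated_E0[of i] by blast+
  moreover have "r i \<notin> S" "h (r i) \<notin> S" "h (r i) \<noteq> r i" by auto
  ultimately have "fresh E (r i)" by (simp add: fresh_def)
  then show ?thesis using that[of "r i"] i by blast
qed

text \<open>
  The elementary step.  A new edge from \<open>e\<close> to \<open>b\<close> on the \<open>f'\<close> side means a new edge from \<open>b\<close> to
  \<open>h e\<close> on the \<open>g'\<close> side, and the two last hypotheses say that neither of them closes a cycle.
\<close>
lemma admissible_insert:
  assumes E: "admissible E" and e: "e \<notin> Domain E" and b: "b \<notin> Range E \<union> S"
    and "(b, e) \<notin> E\<^sup>*" "(h e, b) \<notin> (G E)\<^sup>*"
  shows "admissible (insert (e, b) E)"
proof -
  have E0: "E0 \<subseteq> E" using E by (simp add: admissible_def)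
  have eX: "e \<notin> X" using e E0 by (auto simp: E0_def)
  \<comment> \<open>Points of \<open>X\<close> are entered already by an edge of \<open>E0\<close>, or belong to \<open>S\<close>.\<close>
  have bX: "b \<notin> X"
  proof
    assume "b \<in> X"
    then obtain \<alpha> where \<alpha>: "\<alpha> \<notin> P" "b = \<phi> \<alpha>" by blast
    then obtain \<alpha>' where "\<alpha> = f \<alpha>'" using b by blast
    then show False using \<alpha> b E0 by (auto simp: E0_def)
  qed
  have "Y \<subseteq> Domain (G E0)" unfolding G_E0 by blast
  then have bY: "b \<notin> Y" using b G_mono[OF E0] Domain_G[of E] by blast
  have heY: "h e \<notin> Y"
  proof
    assume "h e \<in> Y"
    then obtain \<beta> where \<beta>: "\<beta> \<notin> Q" "h e = \<psi> \<beta>" by blast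
    then obtain \<beta>' where "\<beta> = g \<beta>'" using \<tau>_neq(1)[of \<beta> e] by (auto simp: \<psi>_def split: if_splits)
    then have "e = q (g \<beta>')" "\<beta>' \<notin> Q" using \<beta> by auto
    then show False using e E0 by (auto simp: E0_def)
  qed
  have "finite_paths (insert (e, b) E) X"
    using E e b eX bX assms(4) by (intro finite_paths_insert) (auto simp: admissible_def)
  moreover have "h e \<notin> Range (G E)" using e by (auto simp: Range_G)
  then have "finite_paths (G (insert (e, b) E)) Y"
    unfolding G_insert using E b bY heY assms(5)
    by (intro finite_paths_insert) (auto simp: admissible_def Domain_G)
  moreover have "finite (insert (e, b) E - E0)"
    using E by (auto simp: admissible_def insert_Diff_if)
  ultimately show ?thesis using E b by (auto simp: admissible_def)
qed

lemma freshD: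
  assumes "fresh E u"
  shows "u \<notin> Domain E" "u \<notin> Range E" "h u \<notin> Domain E" "h u \<notin> Range E"
    "u \<notin> Domain (G E)" "u \<notin> Range (G E)" "h u \<notin> Domain (G E)" "h u \<notin> Range (G E)"
    "u \<notin> S" "h u \<notin> S" "h u \<noteq> u"
  using assms by (auto simp: fresh_def Field_def)

lemma extend_forward:
  assumes E: "admissible E" and x: "x \<notin> Domain E" and u: "fresh E u" and neq: "u \<noteq> x" "u \<noteq> h x"
  shows "admissible (insert (x, u) E)"
proof (rule admissible_insert[OF E x])
  show "u \<notin> Range E \<union> S" using freshD(2,9)[OF u] by simp
  show "(u, x) \<notin> E\<^sup>*" using rtrancl_from_end[of u x E] freshD(1)[OF u] neq by metis
  show "(h x, u) \<notin> (G E)\<^sup>*" using rtrancl_to_beginning[of "h x" u "G E"] freshD(6)[OF u] neq by metis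
qed

lemma extend_backward:
  assumes E: "admissible E" and x: "x \<notin> Range E \<union> S" and u: "fresh E u" and neq: "u \<noteq> x" "h u \<noteq> x"
  shows "admissible (insert (u, x) E)"
proof (rule admissible_insert[OF E freshD(1)[OF u] x])
  show "(x, u) \<notin> E\<^sup>*" using rtrancl_to_beginning[of x u E] freshD(2)[OF u] neq by metis
  show "(h u, x) \<notin> (G E)\<^sup>*" using rtrancl_from_end[of "h u" x "G E"] freshD(7)[OF u] neq by metis
qed

lemma reach_Domain:
  assumes E: "admissible E"
  obtains E' where "E \<subseteq> E'" "admissible E'" "x \<in> Domain E'"
proof (cases "x \<in> Domain E")
  case True
  then show ?thesis using E that by blast
next
  case False
  obtain u where u: "fresh E u" "u \<notin> {x, h x}"
    by (rule fresh_point[OF E, of "{x, h x}"]) auto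
  then have "admissible (insert (x, u) E)" using extend_forward[OF E False] by simp
  then show ?thesis by (rule that[rotated]) auto
qed

lemma reach_Range:
  assumes E: "admissible E"
  obtains E' where "E \<subseteq> E'" "admissible E'" "x \<in> Range E' \<union> S"
proof (cases "x \<in> Range E \<union> S")
  case True
  then show ?thesis using E that by blast
next
  case False
  obtain u where u: "fresh E u" "u \<noteq> x" "h u \<noteq> x"
    by (rule fresh_point[OF E, of "{x}"]) auto
  then have "admissible (insert (u, x) E)" using extend_backward[OF E False] by simp
  then show ?thesis by (rule that[rotated]) auto
qed

text \<open>
  The bridge leads from the end \<open>e\<close> of the path of \<open>x\<close> through a fresh \<open>u\<close> to the beginning \<open>b\<close>
  of the path of \<open>y\<close>.  On the \<open>g'\<close> side it adds the edges from \<open>u\<close> to \<open>h e\<close> and from \<open>b\<close> to \<open>h u\<close>.  Both have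
  an isolated endpoint, whereas a direct edge from \<open>e\<close> to \<open>b\<close> might close a cycle of \<open>g'\<close>.
\<close>
lemma bridge_E:
  assumes E: "admissible E" and "\<not> linked E x y"
    and e: "(x, e) \<in> E\<^sup>*" "e \<notin> Domain E" and b: "(b, y) \<in> E\<^sup>*" "b \<notin> Range E \<union> S"
  obtains E' where "E \<subseteq> E'" "admissible E'" "linked E' x y"
proof -
  obtain u where u: "fresh E u" and neq: "u \<notin> {e, b, h e}" "h u \<notin> {e, b, h e}"
    by (rule fresh_point[OF E, of "{e, b, h e}"]) auto
  let ?E1 = "insert (e, u) E"
  let ?E2 = "insert (u, b) ?E1"
  have E1: "admissible ?E1" using extend_forward[OF E e(2) u] neq by simp
  have fin: "finite_paths E X" using E by (simp add: admissible_def)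
  have "admissible ?E2"
  proof (rule admissible_insert[OF E1])
    show "u \<notin> Domain ?E1" using freshD(1)[OF u] neq by auto
    show "b \<notin> Range ?E1 \<union> S" using b neq by auto
    have "(b, e) \<notin> E\<^sup>*" using end_unreachable_if_not_linked[OF fin e b(1) assms(2)] .
    then show "(b, u) \<notin> ?E1\<^sup>*"
      using rtrancl_insert_to_fresh[of b u e E] freshD(2)[OF u] neq by blast
    have "h u \<notin> Domain (G ?E1)" unfolding G_insert using freshD(7,11)[OF u] by auto
    then show "(h u, b) \<notin> (G ?E1)\<^sup>*" using rtrancl_from_end[of "h u" b "G ?E1"] neq by auto
  qed
  moreover have "linked ?E2 x y" by (rule link_by_edges[OF e(1) b(1), of _ u]) auto
  ultimately show ?thesis by (intro that[of ?E2]) auto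
qed

text \<open>
  The mirror image of \<open>bridge_E\<close>: the bridge on the \<open>g'\<close> side passes through \<open>h u\<close>, and its edges from
  \<open>e\<close> to \<open>h u\<close> and from \<open>h u\<close> to \<open>h c\<close> come from the edges from \<open>u\<close> to \<open>e\<close> and from \<open>c\<close> to \<open>h u\<close> on the
  \<open>f'\<close> side.
\<close>
lemma bridge_G:
  assumes E: "admissible E" and "\<not> linked (G E) x y"
    and e: "(x, e) \<in> (G E)\<^sup>*" "e \<notin> Domain (G E)"
    and b: "(h c, y) \<in> (G E)\<^sup>*" "c \<notin> Domain E"
  obtains E' where "E \<subseteq> E'" "admissible E'" "linked (G E') x y"
proof -
  obtain u where u: "fresh E u" and neq: "u \<notin> {e, c, h c}" "h u \<notin> {e, c, h c}"
    by (rule fresh_point[OF E, of "{e, c, h c}"]) auto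
  let ?E1 = "insert (u, e) E"
  let ?E2 = "insert (c, h u) ?E1"
  have e': "e \<notin> Range E \<union> S" using e(2) by (simp add: Domain_G)
  have E1: "admissible ?E1" using extend_backward[OF E e' u] neq by simp
  have fin: "finite_paths (G E) Y" using E by (simp add: admissible_def)
  have "admissible ?E2"
  proof (rule admissible_insert[OF E1])
    show "c \<notin> Domain ?E1" using b neq by auto
    show "h u \<notin> Range ?E1 \<union> S" using freshD(4,10)[OF u] neq by auto
    have "h u \<notin> Domain ?E1" using freshD(3,11)[OF u] by auto
    then show "(h u, c) \<notin> ?E1\<^sup>*" using rtrancl_from_end[of "h u" c ?E1] neq by auto
    have "(h c, e) \<notin> (G E)\<^sup>*" using end_unreachable_if_not_linked[OF fin e b(1) assms(2)] .
    then show "(h c, h u) \<notin> (G ?E1)\<^sup>*" unfolding G_insert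
      using rtrancl_insert_to_fresh[of "h c" "h u" e "G E"] freshD(8)[OF u] neq by auto
  qed
  moreover have "linked (G ?E2) x y"
    by (rule link_by_edges[OF e(1) b(1), of _ "h u"]) (auto simp: G_insert)
  ultimately show ?thesis by (intro that[of ?E2]) auto
qed

text \<open>
  The points of \<open>S\<close> are not available as targets of new edges.  Apart from the points of the finished part
  \<open>X\<close> this concerns only the image of the start of \<open>P\<close>, if \<open>P\<close> has one.
\<close>
lemma path_start_E:
  assumes E: "admissible E" and "(b, x) \<in> E\<^sup>*" "x \<notin> X" "b \<in> S"
  obtains \<alpha> where "\<alpha> \<in> P" "\<alpha> \<notin> range f" "b = \<phi> \<alpha>"
proof -
  obtain \<alpha> where \<alpha>: "\<alpha> \<notin> range f" "b = \<phi> \<alpha>" using assms(4) by auto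
  have "\<exists>v\<in>X. (u, v) \<in> E" if u: "u \<in> X" for u
  proof -
    obtain \<beta> where \<beta>: "u = \<phi> \<beta>" "\<beta> \<notin> P" using u by auto
    then have "(u, \<phi> (f \<beta>)) \<in> E0" unfolding E0_def by blast
    then have "(u, \<phi> (f \<beta>)) \<in> E" using E by (auto simp: admissible_def)
    moreover have "\<phi> (f \<beta>) \<in> X" using \<beta> by simp
    ultimately show ?thesis by blast
  qed
  moreover have "single_valued E" using E by (simp add: admissible_def finite_paths_def)
  ultimately have "b \<notin> X" using rtrancl_stays[of E X b x] assms(2,3) by metis
  then have "\<alpha> \<in> P" using \<alpha>(2) by auto
  then show ?thesis using that \<alpha> by metis
qed

text \<open>
  The beginning of a path on the \<open>g'\<close> side can be extended backwards if it lies in \<open>range h\<close>.  Off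
  the finished part \<open>Y\<close> the only exception is the image of the start of \<open>Q\<close>, if \<open>Q\<close> has one.
\<close>
lemma path_start_G:
  assumes E: "admissible E" and "(b, x) \<in> (G E)\<^sup>*" "x \<notin> Y" "b \<notin> Range (G E)" "b \<notin> range h"
  obtains \<beta> where "\<beta> \<in> Q" "\<beta> \<notin> range g" "b = \<psi> \<beta>"
proof -
  have "b \<in> \<tau> ` (- range g)" using assms(4,5) cover Range_G[of b E] by auto
  then obtain \<beta> where \<beta>: "\<beta> \<notin> range g" "b = \<psi> \<beta>" by (auto simp: \<psi>_def)
  have "\<exists>v\<in>Y. (u, v) \<in> G E" if u: "u \<in> Y" for u
  proof -
    obtain \<beta> where \<beta>: "u = \<psi> \<beta>" "\<beta> \<notin> Q" using u by auto
    then have "(u, \<psi> (g \<beta>)) \<in> G E0" unfolding G_E0 by blast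
    moreover have "G E0 \<subseteq> G E" using E G_mono by (simp add: admissible_def)
    moreover have "\<psi> (g \<beta>) \<in> Y" using \<beta>(2) by (intro imageI) simp
    ultimately show ?thesis by blast
  qed
  moreover have "single_valued (G E)" using E by (simp add: admissible_def finite_paths_def)
  ultimately have "b \<notin> Y" using rtrancl_stays[of "G E" Y b x] assms(2,3) by metis
  then have "\<beta> \<in> Q" using \<beta>(2) by auto
  then show ?thesis using that \<beta> by metis
qed

text \<open>
  At most one of the two paths begins in \<open>S\<close>, so one of the two orders of joining them is possible.
\<close>
lemma reach_linked_E:
  assumes E: "admissible E" and xy: "x \<notin> X" "y \<notin> X"
  obtains E' where "E \<subseteq> E'" "admissible E'" "linked E' x y"
proof (cases "linked E x y")
  case True
  then show ?thesis using E that by blast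
next
  case False
  have fin: "finite_paths E X" using E by (simp add: admissible_def)
  obtain e b where x: "(x, e) \<in> E\<^sup>*" "e \<notin> Domain E" "(b, x) \<in> E\<^sup>*" "b \<notin> Range E"
    by (rule finite_paths_ends[OF fin xy(1)])
  obtain e' b' where y: "(y, e') \<in> E\<^sup>*" "e' \<notin> Domain E" "(b', y) \<in> E\<^sup>*" "b' \<notin> Range E"
    by (rule finite_paths_ends[OF fin xy(2)])
  have neq: "b \<noteq> b'" using distinct_beginnings[OF fin False x(3) y(3)] .
  have "b \<notin> S \<or> b' \<notin> S"
  proof (rule ccontr)
    assume "\<not> (b \<notin> S \<or> b' \<notin> S)"
    then have "b \<in> S" "b' \<in> S" by simp_all
    obtain \<alpha> where \<alpha>: "\<alpha> \<in> P" "\<alpha> \<notin> range f" "b = \<phi> \<alpha>"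
      by (rule path_start_E[OF E x(3) xy(1) \<open>b \<in> S\<close>])
    obtain \<alpha>' where \<alpha>': "\<alpha>' \<in> P" "\<alpha>' \<notin> range f" "b' = \<phi> \<alpha>'"
      by (rule path_start_E[OF E y(3) xy(2) \<open>b' \<in> S\<close>])
    show False using chain_start_unique[OF P \<alpha>(1) \<alpha>'(1) \<alpha>(2) \<alpha>'(2)] \<alpha>(3) \<alpha>'(3) neq by simp
  qed
  then show ?thesis
  proof
    assume "b' \<notin> S"
    then have "b' \<notin> Range E \<union> S" using y(4) by simp
    then show ?thesis by (rule bridge_E[OF E False x(1,2) y(3)]) (rule that)
  next
    assume "b \<notin> S"
    then have b: "b \<notin> Range E \<union> S" using x(4) by simp
    have "\<not> linked E y x" using False linked_sym by metis
    then show ?thesis using bridge_E[OF E _ y(1,2) x(3) b] that linked_sym by metis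
  qed
qed

lemma reach_linked_G:
  assumes E: "admissible E" and xy: "x \<notin> Y" "y \<notin> Y"
  obtains E' where "E \<subseteq> E'" "admissible E'" "linked (G E') x y"
proof (cases "linked (G E) x y")
  case True
  then show ?thesis using E that by blast
next
  case False
  have fin: "finite_paths (G E) Y" using E by (simp add: admissible_def)
  obtain e b where x: "(x, e) \<in> (G E)\<^sup>*" "e \<notin> Domain (G E)" "(b, x) \<in> (G E)\<^sup>*" "b \<notin> Range (G E)"
    by (rule finite_paths_ends[OF fin xy(1)])
  obtain e' b' where y: "(y, e') \<in> (G E)\<^sup>*" "e' \<notin> Domain (G E)" "(b', y) \<in> (G E)\<^sup>*" "b' \<notin> Range (G E)"
    by (rule finite_paths_ends[OF fin xy(2)])
  have neq: "b \<noteq> b'" using distinct_beginnings[OF fin False x(3) y(3)] .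
  have "b \<in> range h \<or> b' \<in> range h"
  proof (rule ccontr)
    assume "\<not> (b \<in> range h \<or> b' \<in> range h)"
    then have "b \<notin> range h" "b' \<notin> range h" by simp_all
    obtain \<beta> where \<beta>: "\<beta> \<in> Q" "\<beta> \<notin> range g" "b = \<psi> \<beta>"
      by (rule path_start_G[OF E x(3) xy(1) x(4) \<open>b \<notin> range h\<close>])
    obtain \<beta>' where \<beta>': "\<beta>' \<in> Q" "\<beta>' \<notin> range g" "b' = \<psi> \<beta>'"
      by (rule path_start_G[OF E y(3) xy(2) y(4) \<open>b' \<notin> range h\<close>])
    show False using chain_start_unique[OF Q \<beta>(1) \<beta>'(1) \<beta>(2) \<beta>'(2)] \<beta>(3) \<beta>'(3) neq by simp
  qed
  then show ?thesis
  proof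
    assume "b' \<in> range h"
    then obtain c where c: "b' = h c" by auto
    then have "c \<notin> Domain E" using y(4) Range_G[of b' E] by auto
    then show ?thesis by (rule bridge_G[OF E False x(1,2) y(3)[unfolded c]]) (rule that)
  next
    assume "b \<in> range h"
    then obtain c where c: "b = h c" by auto
    then have dom: "c \<notin> Domain E" using x(4) Range_G[of b E] by auto
    have "\<not> linked (G E) y x" using False linked_sym by metis
    then show ?thesis using bridge_G[OF E _ y(1,2) x(3)[unfolded c] dom] that linked_sym by metis
  qed
qed

text \<open>
  All requirements for the pair \<open>(x, y)\<close> in one predicate: \<open>f'\<close> is defined at \<open>x\<close>, takes the value \<open>x\<close> if it
  should, and \<open>x\<close> and \<open>y\<close> lie on a common chain of \<open>f'\<close> and of \<open>g'\<close> off the finished parts.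
\<close>
definition settled :: "nat \<Rightarrow> nat \<Rightarrow> (nat \<times> nat) set \<Rightarrow> bool" where
  "settled x y E \<longleftrightarrow> x \<in> Domain E \<and> x \<in> Range E \<union> S \<and>
     (x \<notin> X \<longrightarrow> y \<notin> X \<longrightarrow> linked E x y) \<and> (x \<notin> Y \<longrightarrow> y \<notin> Y \<longrightarrow> linked (G E) x y)"

lemma settled_mono:
  assumes "settled x y E" "E \<subseteq> E'"
  shows "settled x y E'"
  unfolding settled_def
proof (intro conjI impI)
  show "x \<in> Domain E'" using assms Domain_mono unfolding settled_def by fast
  show "x \<in> Range E' \<union> S" using assms Range_mono[OF assms(2)] unfolding settled_def by fast
  show "linked E' x y" if "x \<notin> X" "y \<notin> X"
    using that assms linked_mono unfolding settled_def by metis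
  show "linked (G E') x y" if "x \<notin> Y" "y \<notin> Y"
    using that assms linked_mono G_mono unfolding settled_def by metis
qed

lemma reach_settled:
  assumes "admissible E"
  shows "\<exists>E'. E \<subseteq> E' \<and> admissible E' \<and> settled x y E'"
proof -
  obtain E1 where E1: "E \<subseteq> E1" "admissible E1" "x \<in> Domain E1" by (rule reach_Domain[OF assms])
  obtain E2 where E2: "E1 \<subseteq> E2" "admissible E2" "x \<in> Range E2 \<union> S" by (rule reach_Range[OF E1(2)])
  obtain E3 where E3: "E2 \<subseteq> E3" "admissible E3" "x \<notin> X \<longrightarrow> y \<notin> X \<longrightarrow> linked E3 x y"
    using reach_linked_E[OF E2(2), of x y] E2(2) subset_refl[of E2] by metis
  obtain E4 where E4: "E3 \<subseteq> E4" "admissible E4" "x \<notin> Y \<longrightarrow> y \<notin> Y \<longrightarrow> linked (G E4) x y"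
    using reach_linked_G[OF E3(2), of x y] E3(2) subset_refl[of E3] by metis
  have sub: "E1 \<subseteq> E4" "E2 \<subseteq> E4" "E \<subseteq> E4" using E1(1) E2(1) E3(1) E4(1) by simp_all
  have "settled x y E4"
    unfolding settled_def
  proof (intro conjI)
    show "x \<in> Domain E4" using E1(3) Domain_mono[OF sub(1)] by (rule rev_subsetD)
    show "x \<in> Range E4 \<union> S" using E2(3) Range_mono[OF sub(2)] by auto
    show "x \<notin> X \<longrightarrow> y \<notin> X \<longrightarrow> linked E4 x y" using E3(3) linked_mono[OF _ E4(1)] by metis
  qed (fact E4(3))
  then show ?thesis using sub(3) E4(2) by (intro exI conjI)
qed

lemma limit_relation:
  obtains E where "E0 \<subseteq> E" "single_valued E" "single_valued (E\<inverse>)" "Range E \<inter> S = {}"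
    "\<And>x y. settled x y E"
proof -
  obtain E where E: "\<And>n. admissible (E n)" "\<And>n. E n \<subseteq> E (Suc n)"
    "\<And>n. settled (fst (prod_decode n)) (snd (prod_decode n)) (E (Suc n))" "E 0 = E0"
    by (rule generic_chain[where D = "\<lambda>n. settled (fst (prod_decode n)) (snd (prod_decode n))",
          OF admissible_E0 reach_settled])
      (assumption, rule that, assumption+)
  let ?U = "\<Union>n. E n"
  have mono: "E m \<subseteq> E n" if "m \<le> n" for m n using lift_Suc_mono_le[of E] E(2) that by blast
  \<comment> \<open>A property of any two edges holds in the union, because two edges lie in a common stage.\<close>
  have common: "\<exists>n. a \<in> E n \<and> b \<in> E n" if ab: "a \<in> ?U" "b \<in> ?U" for a b
  proof -
    obtain m n where "a \<in> E m" "b \<in> E n" using ab by auto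
    then have "a \<in> E (max m n)" "b \<in> E (max m n)"
      using mono[of m "max m n"] mono[of n "max m n"] by auto
    then show ?thesis by blast
  qed
  have "single_valued (E n)" "single_valued ((E n)\<inverse>)" "Range (E n) \<inter> S = {}" for n
    using E(1)[of n] by (auto simp: admissible_def finite_paths_def)
  note sv = this
  have "single_valued ?U"
    unfolding single_valued_def using common sv(1) by (metis single_valuedD)
  moreover have "single_valued (?U\<inverse>)"
    unfolding single_valued_def converse_iff using common sv(2)
    by (metis single_valuedD converse_iff)
  moreover have "Range ?U \<inter> S = {}" using sv(3) unfolding Range_Union by auto
  moreover have "settled x y ?U" for x y
  proof (rule settled_mono)
    show "settled x y (E (Suc (prod_encode (x, y))))" using E(3)[of "prod_encode (x, y)"] by simp
  qed (rule UN_upper, simp)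
  moreover have "E0 \<subseteq> ?U" using E(4) by blast
  ultimately show ?thesis using that by blast
qed

text \<open>
  The limit of the back-and-forth construction is the graph of a total map \<open>f'\<close>, and it forces the graph of
  a total map \<open>g'\<close> with \<open>g' \<circ> f' = h\<close>.  Both are recognised by \<open>conjugate_if_one_chain_remains\<close>.
\<close>
lemma factorisation:
  obtains a b where "bij a" "bij b" "\<And>x y. a y = f (a x) \<Longrightarrow> b (h x) = g (b y)"
proof -
  obtain E where E: "E0 \<subseteq> E" "single_valued E" "single_valued (E\<inverse>)" "Range E \<inter> S = {}"
    and settled: "\<And>x y. settled x y E" by (rule limit_relation, rule that, assumption+)
  have dom: "x \<in> Domain E" and ran: "x \<in> Range E \<union> S" for x
    using settled[of x x] unfolding settled_def by simp_all
  have "\<forall>x. \<exists>y. (x, y) \<in> E" using dom by (simp add: Domain_iff)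
  then obtain f' where "\<And>x. (x, f' x) \<in> E" by metis
  then have E_graph: "E = {(x, f' x) |x. True}" using single_valuedD[OF E(2)] by auto
  have inj_f': "inj f'"
    using E(3) unfolding E_graph by (auto simp: inj_def single_valued_def)
  have range_f': "range f' = - S"
  proof -
    have "range f' = Range E" unfolding E_graph by auto
    moreover have "z \<in> Range E \<longleftrightarrow> z \<notin> S" for z using E(4) ran[of z] by blast
    ultimately show ?thesis by (simp add: set_eq_iff)
  qed
  have "\<forall>x. \<exists>y. (x, y) \<in> G E" using ran Domain_G[of E] by (simp add: Domain_iff[symmetric])
  then obtain g' where g': "\<And>x. (x, g' x) \<in> G E" by metis
  have G_sv: "single_valued (G E)" "single_valued ((G E)\<inverse>)"
    using E(2-4) inj_onD[OF inj_\<sigma>] unfolding G_def single_valued_def by auto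
  have G_graph: "G E = {(x, g' x) |x. True}" using g' single_valuedD[OF G_sv(1)] by auto
  have inj_g': "inj g'"
    using G_sv(2) unfolding G_graph by (auto simp: inj_def single_valued_def)
  have range_g': "range g' = - \<tau> ` (- range g)"
  proof -
    have "range g' = Range (G E)" unfolding G_graph by auto
    also have "\<dots> = range h \<union> \<sigma> ` (- range f)"
    proof (rule set_eqI)
      have "Domain E = UNIV" using dom by blast
      then show "z \<in> Range (G E) \<longleftrightarrow> z \<in> range h \<union> \<sigma> ` (- range f)" for z
        using Range_G[of z E] by simp
    qed
    also have "\<dots> = - \<tau> ` (- range g)" using cover disj by blast
    finally show ?thesis .
  qed
  have comp: "g' (f' x) = h x" for x
  proof -
    have "(f' x, h x) \<in> G E" by (auto simp: G_def E_graph)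
    then show ?thesis unfolding G_graph by simp
  qed
  have f'_\<phi>: "f' (\<phi> \<alpha>) = \<phi> (f \<alpha>)" if \<alpha>: "\<alpha> \<notin> P" for \<alpha>
  proof -
    have "(\<phi> \<alpha>, \<phi> (f \<alpha>)) \<in> E" using E(1) \<alpha> by (auto simp: E0_def)
    then show ?thesis unfolding E_graph by simp
  qed
  have g'_\<psi>: "g' (\<psi> \<beta>) = \<psi> (g \<beta>)" if \<beta>: "\<beta> \<notin> Q" for \<beta>
  proof -
    have "(\<psi> \<beta>, \<psi> (g \<beta>)) \<in> G E0" using \<beta> unfolding G_E0 by blast
    then have "(\<psi> \<beta>, \<psi> (g \<beta>)) \<in> G E" using G_mono[OF E(1)] by (rule rev_subsetD)
    then show ?thesis unfolding G_graph by simp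
  qed
  have bij_X: "bij_betw \<phi> (- P) X" "bij_betw \<psi> (- Q) Y"
    by (auto simp: bij_betw_def inj_on_def)
  have inf: "infinite (- X)" "infinite (- Y)"
  proof -
    have "infinite (range r)" by (rule range_inj_infinite) (simp add: inj_def)
    moreover have "range r \<subseteq> - X" "range r \<subseteq> - Y" by auto
    ultimately show "infinite (- X)" "infinite (- Y)" using finite_subset by metis+
  qed
  have X_closed: "f' x \<in> X \<longleftrightarrow> x \<in> X" for x
  proof (rule conjugated_image_closed[where f = f and \<theta> = \<phi>, OF inj_f' f'_\<phi> f_P])
    show "\<alpha> \<in> range f" if "\<phi> \<alpha> \<in> range f'" for \<alpha>
      using that unfolding range_f' by (metis ComplD ComplI imageI)
  qed
  have Y_closed: "g' x \<in> Y \<longleftrightarrow> x \<in> Y" for x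
  proof (rule conjugated_image_closed[where f = g and \<theta> = \<psi>, OF inj_g' g'_\<psi> g_Q])
    fix \<beta> assume \<beta>: "\<psi> \<beta> \<in> range g'"
    show "\<beta> \<in> range g"
    proof (rule ccontr)
      assume "\<beta> \<notin> range g"
      then have "\<psi> \<beta> = \<tau> \<beta>" "\<beta> \<in> - range g" by (simp_all add: \<psi>_def)
      then have "\<psi> \<beta> \<in> \<tau> ` (- range g)" by simp
      then show False using \<beta> unfolding range_g' by simp
    qed
  qed
  have "infinite_chain f' (- X)"
    unfolding infinite_chain_def cycle_closed_def
  proof (intro conjI inf ballI allI)
    fix x y assume "x \<in> - X" "y \<in> - X"
    then have "linked E x y" using settled[of x y] by (simp add: settled_def)
    then show "\<exists>n. (f' ^^ n) x = y \<or> (f' ^^ n) y = x"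
      using rtrancl_graph[of _ _ f'] unfolding linked_def E_graph by blast
  qed (use X_closed in simp)
  moreover have "P \<subseteq> range f \<longleftrightarrow> - X \<subseteq> range f'"
  proof -
    have "\<phi> \<alpha> \<in> X \<longleftrightarrow> \<alpha> \<notin> P" for \<alpha> by auto
    then show ?thesis unfolding range_f' by blast
  qed
  ultimately obtain a where a: "bij a" "\<And>x. a (f' x) = f (a x)"
    using conjugate_if_one_chain_remains[OF inj_f inj_f' P _ bij_X(1) f'_\<phi>] by blast
  have "infinite_chain g' (- Y)"
    unfolding infinite_chain_def cycle_closed_def
  proof (intro conjI inf ballI allI)
    fix x y assume "x \<in> - Y" "y \<in> - Y"
    then have "linked (G E) x y" using settled[of x y] by (simp add: settled_def)
    then show "\<exists>n. (g' ^^ n) x = y \<or> (g' ^^ n) y = x"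
      using rtrancl_graph[of _ _ g'] unfolding linked_def G_graph by blast
  qed (use Y_closed in simp)
  moreover have "Q \<subseteq> range g \<longleftrightarrow> - Y \<subseteq> range g'"
  proof -
    have "\<tau> \<beta> \<in> Y \<longleftrightarrow> \<beta> \<notin> Q" if "\<beta> \<notin> range g" for \<beta>
    proof -
      have "\<tau> \<beta> = \<psi> \<beta>" using that by (simp add: \<psi>_def)
      then show ?thesis by auto
    qed
    then show ?thesis unfolding range_g' by blast
  qed
  ultimately obtain b where b: "bij b" "\<And>x. b (g' x) = g (b x)"
    using conjugate_if_one_chain_remains[OF inj_g inj_g' Q _ bij_X(2) g'_\<psi>] by blast
  have "b (h x) = g (b y)" if "a y = f (a x)" for x y
  proof -
    have "a y = a (f' x)" using that a(2) by simp
    then have "y = f' x" using a(1) by (meson bij_is_inj injD)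
    then show ?thesis using b(2) comp by metis
  qed
  then show ?thesis using that a(1) b(1) by blast
qed

end

section \<open>The countable case\<close>

text \<open>
  The factorisation of \<open>h\<close> on \<open>C\<close> into a conjugate of \<open>f\<close> on \<open>A\<close> and a conjugate of \<open>g\<close> on \<open>B\<close>, written
  without inverses.  The three maps live on different carriers so that pieces of \<open>f\<close>, \<open>g\<close> and \<open>h\<close> can be
  matched freely.
\<close>
definition factors where
  "factors C h A f B g \<longleftrightarrow> (\<exists>a b. bij_betw a C A \<and> bij_betw b C B \<and>
     (\<forall>x\<in>C. \<forall>y\<in>C. a y = f (a x) \<longrightarrow> b (h x) = g (b y)))"

lemma factors_transport:
  assumes fac: "factors UNIV h' UNIV f' UNIV g'"
    and c: "bij_betw c UNIV C" "\<And>n. h (c n) = c (h' n)"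
    and \<alpha>: "bij_betw \<alpha> UNIV A" "\<And>n. f (\<alpha> n) = \<alpha> (f' n)"
    and \<beta>: "bij_betw \<beta> UNIV B" "\<And>n. g (\<beta> n) = \<beta> (g' n)"
  shows "factors C h A f B g"
proof -
  obtain a b where a: "bij a" and b: "bij b" and ab: "\<And>x y. a y = f' (a x) \<Longrightarrow> b (h' x) = g' (b y)"
    using fac unfolding factors_def by auto
  define d where "d = inv_into UNIV c"
  have d: "bij_betw d C UNIV" "\<And>n. d (c n) = n" "\<And>x. x \<in> C \<Longrightarrow> c (d x) = x"
    using c(1) unfolding d_def
    by (auto simp: bij_betw_inv_into bij_betw_inv_into_left bij_betw_inv_into_right)
  have "bij_betw (\<alpha> \<circ> (a \<circ> d)) C A" "bij_betw (\<beta> \<circ> (b \<circ> d)) C B"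
    using d(1) a b \<alpha>(1) \<beta>(1) by (meson bij_betw_trans)+
  moreover have "(\<beta> \<circ> (b \<circ> d)) (h x) = g ((\<beta> \<circ> (b \<circ> d)) y)"
    if "x \<in> C" "y \<in> C" "(\<alpha> \<circ> (a \<circ> d)) y = f ((\<alpha> \<circ> (a \<circ> d)) x)" for x y
  proof -
    have "\<alpha> (a (d y)) = \<alpha> (f' (a (d x)))" using that(3) \<alpha>(2) by simp
    then have "a (d y) = f' (a (d x))" using \<alpha>(1) by (simp add: bij_betw_def inj_eq)
    then have "b (h' (d x)) = g' (b (d y))" by (rule ab)
    moreover have "d (h x) = h' (d x)" using c(2)[of "d x"] d(2,3) that(1) by simp
    ultimately show ?thesis using \<beta>(2) by simp
  qed
  ultimately show ?thesis unfolding factors_def by blast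
qed

text \<open>
  Only finitely many points conflict with those chosen before, since \<open>h\<close> is injective.
\<close>
lemma independent_points:
  assumes "inj h" and "infinite H" and moved: "\<And>x. x \<in> H \<Longrightarrow> h x \<noteq> x"
  obtains p :: "nat \<Rightarrow> 'a" where "inj p" "\<And>i. p i \<in> H" "\<And>i j. p i \<noteq> h (p j)"
proof -
  \<comment> \<open>\<open>r\<close> may be chosen as the point number \<open>n\<close>: it keeps \<open>r\<close> and \<open>h r\<close> apart from all earlier points.\<close>
  let ?ok = "\<lambda>p n r. r \<in> H \<and> r \<notin> p ` {..<n} \<union> h ` p ` {..<n} \<union> h -` (p ` {..<n})"
  have "\<exists>p :: nat \<Rightarrow> 'a. \<forall>n. ?ok p n (p n)"
  proof (rule dependent_wellorder_choice)
    fix r and p p' :: "nat \<Rightarrow> 'a" and n :: nat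
    assume "\<And>m. m < n \<Longrightarrow> p m = p' m"
    then have "p ` {..<n} = p' ` {..<n}" by (intro image_cong) simp_all
    then show "?ok p n r \<longleftrightarrow> ?ok p' n r" by simp
  next
    fix n :: nat and p :: "nat \<Rightarrow> 'a"
    let ?F = "p ` {..<n} \<union> h ` p ` {..<n} \<union> h -` (p ` {..<n})"
    have "finite ?F" using finite_vimageI[OF _ \<open>inj h\<close>, of "p ` {..<n}"] by simp
    then have "infinite (H - ?F)" using \<open>infinite H\<close> by (rule Diff_infinite_finite)
    then have "H - ?F \<noteq> {}" by (rule infinite_imp_nonempty)
    then obtain r where "r \<in> H - ?F" unfolding ex_in_conv[symmetric] ..
    then show "\<exists>r. ?ok p n r" by (intro exI[of _ r]) simp
  qed
  then obtain p :: "nat \<Rightarrow> 'a" where "\<forall>n. ?ok p n (p n)" ..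
  then have earlier: "p n \<noteq> p m" "p n \<noteq> h (p m)" "h (p n) \<noteq> p m" if "m < n" for m n
    using that by (auto simp: image_iff)
  have H: "p n \<in> H" for n using \<open>\<forall>n. ?ok p n (p n)\<close> by simp
  have "inj p" by (rule linorder_injI) (use earlier(1) in metis)
  moreover have "p i \<noteq> h (p j)" for i j
    using earlier(2)[of j i] earlier(3)[of i j] moved[OF H[of i]] by (metis linorder_neqE_nat)
  ultimately show ?thesis using that H by metis
qed

text \<open>
  The points \<open>p i\<close> are taken from \<open>h ` support h\<close>, which makes them moved points in the range of \<open>h\<close>.
\<close>
lemma factors_nat:
  fixes f g h :: "nat \<Rightarrow> nat"
  assumes inj: "inj f" "inj g" "inj h" and "infinite (support h)"
    and chains: "infinite_chain f P" "infinite_chain g Q"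
    and defects: "|- range f| +c |- range g| =o |- range h|"
  shows "factors UNIV h UNIV f UNIV g"
proof -
  have "|(- range f) <+> (- range g)| =o |- range h|"
    using defects by (simp add: csum_def Field_card_of)
  then obtain s where s: "bij_betw s ((- range f) <+> (- range g)) (- range h)"
    using card_of_ordIso by blast
  define \<sigma> \<tau> where "\<sigma> = s \<circ> Inl" and "\<tau> = s \<circ> Inr"
  let ?Df = "Inl ` (- range f) :: (nat + nat) set" and ?Dg = "Inr ` (- range g) :: (nat + nat) set"
  have s_inj: "inj_on s (?Df \<union> ?Dg)" and s_img: "s ` (?Df \<union> ?Dg) = - range h"
    using s by (simp_all add: bij_betw_def Plus_def)
  have imgs: "\<sigma> ` (- range f) = s ` ?Df" "\<tau> ` (- range g) = s ` ?Dg"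
    unfolding \<sigma>_def \<tau>_def by (simp_all only: image_comp)
  have cover: "\<sigma> ` (- range f) \<union> \<tau> ` (- range g) = - range h"
    unfolding imgs image_Un[symmetric] by (rule s_img)
  have "?Df \<inter> ?Dg = {}" by blast
  then have disj: "\<sigma> ` (- range f) \<inter> \<tau> ` (- range g) = {}"
    unfolding imgs using inj_on_image_Int[OF s_inj, of ?Df ?Dg] by simp
  have inj_st: "inj_on \<sigma> (- range f)" "inj_on \<tau> (- range g)"
    unfolding \<sigma>_def \<tau>_def using s_inj by (simp_all add: comp_inj_on inj_on_Un)
  let ?H = "h ` support h"
  have inf: "infinite ?H"
    using \<open>infinite (support h)\<close> \<open>inj h\<close> by (simp add: finite_image_iff inj_on_subset)
  have moved: "h x \<noteq> x" if "x \<in> ?H" for x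
    using that \<open>inj h\<close> by (auto simp: support_def dest: injD)
  obtain p :: "nat \<Rightarrow> nat" where p: "inj p" "\<And>i. p i \<in> ?H" "\<And>i j. p i \<noteq> h (p j)"
    by (rule independent_points[OF \<open>inj h\<close> inf moved], assumption, rule that, assumption+)
  have "p i \<in> range h" for i using p(2)[of i] by auto
  then interpret countable_construction f g h P Q \<sigma> \<tau> p
    using inj chains p(1,3) cover disj inj_st by unfold_locales
  obtain a b where "bij a" "bij b" "\<And>x y. a y = f (a x) \<Longrightarrow> b (h x) = g (b y)"
    by (rule factorisation, rule that, assumption+)
  then show ?thesis unfolding factors_def by blast
qed

lemma card_of_image_inj: "inj \<theta> \<Longrightarrow> \<theta> ` X = Z \<Longrightarrow> |X| =o |Z|"
  by (rule card_of_ordIsoI[of \<theta>]) (auto simp: bij_betw_def inj_on_def inj_def)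

lemma countable_infinite_chain_pullback:
  fixes f :: "'a \<Rightarrow> 'a"
  assumes "countable A" "infinite A" "inj f" and A: "cycle_closed f A"
  obtains \<alpha> :: "nat \<Rightarrow> 'a" and f' where "bij_betw \<alpha> UNIV A" "inj f'" "\<And>n. f (\<alpha> n) = \<alpha> (f' n)"
    "\<alpha> ` (- range f') = A - range f"
    "\<And>P. infinite_chain f P \<Longrightarrow> P \<subseteq> A \<Longrightarrow> infinite_chain f' (\<alpha> -` P)"
proof -
  let ?\<alpha> = "from_nat_into A"
  have \<alpha>: "bij_betw ?\<alpha> UNIV A" using assms(1,2) by (rule bij_betw_from_nat_into)
  have inj: "?\<alpha> m = ?\<alpha> n \<longleftrightarrow> m = n" for m n using \<alpha> by (simp add: bij_betw_def inj_eq)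
  have mem: "?\<alpha> n \<in> A" for n using \<alpha> by (auto simp: bij_betw_def)
  have sur: "\<exists>n. x = ?\<alpha> n" if "x \<in> A" for x using \<alpha> that by (auto simp: bij_betw_def)
  have "\<forall>n. \<exists>m. f (?\<alpha> n) = ?\<alpha> m" using sur mem A by (metis cycle_closed_def)
  then obtain f' where f': "\<And>n. f (?\<alpha> n) = ?\<alpha> (f' n)" by metis
  have pow: "(f ^^ k) (?\<alpha> n) = ?\<alpha> ((f' ^^ k) n)" for k n by (induction k) (simp_all add: f')
  have "inj f'"
  proof (rule injI)
    fix m n assume "f' m = f' n"
    then have "f (?\<alpha> m) = f (?\<alpha> n)" by (simp add: f')
    then show "m = n" using \<open>inj f\<close> inj by (simp add: inj_eq)
  qed
  moreover have "?\<alpha> ` (- range f') = A - range f"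
  proof -
    have range_iff: "n \<in> range f' \<longleftrightarrow> ?\<alpha> n \<in> range f" for n
    proof
      assume "?\<alpha> n \<in> range f"
      then obtain x where x: "?\<alpha> n = f x" by blast
      then have "x \<in> A" using mem[of n] A by (simp add: cycle_closed_def)
      then obtain m where "x = ?\<alpha> m" using sur by blast
      then have "n = f' m" using x f' inj by simp
      then show "n \<in> range f'" by blast
    next
      assume "n \<in> range f'"
      then obtain m where "n = f' m" by blast
      then have "?\<alpha> n = f (?\<alpha> m)" using f' by simp
      then show "?\<alpha> n \<in> range f" by simp
    qed
    show ?thesis
    proof
      show "?\<alpha> ` (- range f') \<subseteq> A - range f" using mem range_iff by auto
      show "A - range f \<subseteq> ?\<alpha> ` (- range f')"
      proof
        fix x assume x: "x \<in> A - range f"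
        then obtain n where "x = ?\<alpha> n" using sur by blast
        moreover from this have "n \<in> - range f'" using range_iff[of n] x by simp
        ultimately show "x \<in> ?\<alpha> ` (- range f')" by blast
      qed
    qed
  qed
  moreover have "infinite_chain f' (?\<alpha> -` P)" if P: "infinite_chain f P" "P \<subseteq> A" for P
    unfolding infinite_chain_def cycle_closed_def
  proof (intro conjI allI ballI)
    have "P \<subseteq> ?\<alpha> ` (?\<alpha> -` P)" using P(2) sur by blast
    then show "infinite (?\<alpha> -` P)"
      using P(1) unfolding infinite_chain_def by (meson finite_imageI finite_subset)
    show "f' n \<in> ?\<alpha> -` P \<longleftrightarrow> n \<in> ?\<alpha> -` P" for n
      using P(1) f'[of n] by (simp add: infinite_chain_def cycle_closed_def) metis
    fix m n assume "m \<in> ?\<alpha> -` P" "n \<in> ?\<alpha> -` P"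
    then show "\<exists>k. (f' ^^ k) m = n \<or> (f' ^^ k) n = m"
      using P(1) unfolding infinite_chain_def by (metis pow inj vimageE)
  qed
  ultimately show ?thesis using that[of ?\<alpha> f'] \<alpha> f' by blast
qed

lemma factors_countable:
  assumes "inj f" "inj g" "inj h"
    and C: "countable C" "cycle_closed h C" "infinite (C \<inter> support h)"
    and A: "countable A" "cycle_closed f A" "infinite_chain f P" "P \<subseteq> A"
    and B: "countable B" "cycle_closed g B" "infinite_chain g Q" "Q \<subseteq> B"
    and defects: "|A - range f| +c |B - range g| =o |C - range h|"
  shows "factors C h A f B g"
proof -
  have "infinite A" using A(3,4) finite_subset unfolding infinite_chain_def by blast
  obtain \<alpha> :: "nat \<Rightarrow> _" and f' where \<alpha>: "bij_betw \<alpha> UNIV A" "inj f'"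
    "\<And>n. f (\<alpha> n) = \<alpha> (f' n)" "\<alpha> ` (- range f') = A - range f"
    and f'_chain: "\<And>P. infinite_chain f P \<Longrightarrow> P \<subseteq> A \<Longrightarrow> infinite_chain f' (\<alpha> -` P)"
    by (rule countable_infinite_chain_pullback[OF A(1) \<open>infinite A\<close> \<open>inj f\<close> A(2)],
        rule that, assumption+)
  have "infinite B" using B(3,4) finite_subset unfolding infinite_chain_def by blast
  obtain \<beta> :: "nat \<Rightarrow> _" and g' where \<beta>: "bij_betw \<beta> UNIV B" "inj g'"
    "\<And>n. g (\<beta> n) = \<beta> (g' n)" "\<beta> ` (- range g') = B - range g"
    and g'_chain: "\<And>P. infinite_chain g P \<Longrightarrow> P \<subseteq> B \<Longrightarrow> infinite_chain g' (\<beta> -` P)"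
    by (rule countable_infinite_chain_pullback[OF B(1) \<open>infinite B\<close> \<open>inj g\<close> B(2)],
        rule that, assumption+)
  have "infinite C" using C(3) by auto
  obtain c :: "nat \<Rightarrow> _" and h' where c: "bij_betw c UNIV C" "inj h'"
    "\<And>n. h (c n) = c (h' n)" "c ` (- range h') = C - range h"
    and h'_chain: "\<And>P. infinite_chain h P \<Longrightarrow> P \<subseteq> C \<Longrightarrow> infinite_chain h' (c -` P)"
    by (rule countable_infinite_chain_pullback[OF C(1) \<open>infinite C\<close> \<open>inj h\<close> C(2)],
        rule that, assumption+)
  have "C \<inter> support h \<subseteq> c ` support h'"
    using c(1,3) by (auto simp: support_def bij_betw_def image_iff)
  then have "infinite (support h')" using C(3) finite_subset by blast
  moreover have "|- range f'| +c |- range g'| =o |- range h'|"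
  proof -
    have "inj \<alpha>" "inj \<beta>" "inj c" using \<alpha>(1) \<beta>(1) c(1) by (auto simp: bij_betw_def)
    then have "|- range f'| +c |- range g'| =o |A - range f| +c |B - range g|"
      using \<alpha>(4) \<beta>(4) by (intro csum_cong card_of_image_inj)
    moreover have "|C - range h| =o |- range h'|"
      using card_of_image_inj[OF \<open>inj c\<close> c(4)] by (rule ordIso_symmetric)
    ultimately show ?thesis using defects by (meson ordIso_transitive)
  qed
  ultimately have "factors UNIV h' UNIV f' UNIV g'"
    using factors_nat[OF \<alpha>(2) \<beta>(2) c(2) _ f'_chain[OF A(3,4)] g'_chain[OF B(3,4)]] by blast
  then show ?thesis
    using c(1,3) \<alpha>(1,3) \<beta>(1,3)
    by (rule factors_transport[where c = c and \<alpha> = \<alpha> and \<beta> = \<beta> and h' = h' and f' = f' and g' = g'])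
qed

section \<open>Decomposition into countable pieces\<close>

text \<open>
  The bijection of each class \<open>e\<close> onto \<open>\<pi> ` e\<close> may differ from \<open>\<pi>\<close>, but as \<open>\<pi>\<close> carries the
  partition into classes to a partition, together they are a permutation.
\<close>
lemma glue_bij:
  assumes R: "equiv UNIV R" and "bij \<pi>"
    and A: "\<And>e. e \<in> UNIV // R \<Longrightarrow> bij_betw (A e) e (\<pi> ` e)"
  shows "bij (\<lambda>x. A (R `` {x}) x)"
proof (rule bijI)
  have cls: "R `` {x} \<in> UNIV // R" "x \<in> R `` {x}" for x
    using equiv_class_self[OF R UNIV_I] by (simp_all add: quotientI)
  have img: "A (R `` {x}) x \<in> \<pi> ` (R `` {x})" for x
    using A[OF cls(1)] cls(2) by (metis bij_betwE)
  have same: "R `` {x} = R `` {y}" if "\<pi> z \<in> \<pi> ` (R `` {x})" "z \<in> R `` {y}" for x y z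
  proof -
    have "z \<in> R `` {x}" using that(1) \<open>bij \<pi>\<close> by (auto simp: bij_def inj_eq)
    then show ?thesis using that(2) R by (metis Image_singleton_iff equiv_class_eq_iff)
  qed
  show "inj (\<lambda>x. A (R `` {x}) x)"
  proof (rule injI)
    fix x y assume eq: "A (R `` {x}) x = A (R `` {y}) y"
    obtain z where z: "A (R `` {y}) y = \<pi> z" "z \<in> R `` {y}" using img[of y] by blast
    then have "R `` {x} = R `` {y}" using same[of z x y] img[of x] eq by simp
    then show "x = y" using eq A[OF cls(1)[of x]] cls(2)[of x] cls(2)[of y]
      by (metis bij_betw_imp_inj_on inj_onD)
  qed
  show "surj (\<lambda>x. A (R `` {x}) x)"
    unfolding surj_def
  proof
    fix y
    obtain z where z: "y = \<pi> z" using \<open>bij \<pi>\<close> by (meson bij_pointE)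
    then have "y \<in> A (R `` {z}) ` (R `` {z})"
      using A[OF cls(1)[of z]] cls(2)[of z] by (simp add: bij_betw_def)
    then obtain x where x: "x \<in> R `` {z}" "y = A (R `` {z}) x" by blast
    then have "R `` {x} = R `` {z}" using R by (metis Image_singleton_iff equiv_class_eq_iff)
    then show "\<exists>x. y = A (R `` {x}) x" using x(2) by metis
  qed
qed

lemma factors_glue:
  assumes R: "equiv UNIV R" and \<pi>: "bij \<pi>" "bij \<rho>"
    and closed: "\<And>e. e \<in> UNIV // R \<Longrightarrow> cycle_closed h e" "\<And>e. e \<in> UNIV // R \<Longrightarrow> cycle_closed f (\<pi> ` e)"
    and fac: "\<And>e. e \<in> UNIV // R \<Longrightarrow> factors e h (\<pi> ` e) f (\<rho> ` e) g"
  shows "factors UNIV h UNIV f UNIV g"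
proof -
  have "\<forall>e\<in>UNIV // R. \<exists>a b. bij_betw a e (\<pi> ` e) \<and> bij_betw b e (\<rho> ` e) \<and>
     (\<forall>x\<in>e. \<forall>y\<in>e. a y = f (a x) \<longrightarrow> b (h x) = g (b y))"
    using fac unfolding factors_def by simp
  then obtain A where "\<forall>e\<in>UNIV // R. \<exists>b. bij_betw (A e) e (\<pi> ` e) \<and> bij_betw b e (\<rho> ` e) \<and>
     (\<forall>x\<in>e. \<forall>y\<in>e. A e y = f (A e x) \<longrightarrow> b (h x) = g (b y))"
    unfolding bchoice_iff by blast
  then obtain B where AB: "\<forall>e\<in>UNIV // R. bij_betw (A e) e (\<pi> ` e) \<and> bij_betw (B e) e (\<rho> ` e) \<and>
     (\<forall>x\<in>e. \<forall>y\<in>e. A e y = f (A e x) \<longrightarrow> B e (h x) = g (B e y))"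
    unfolding bchoice_iff by blast
  let ?a = "\<lambda>x. A (R `` {x}) x" and ?b = "\<lambda>x. B (R `` {x}) x"
  have bij: "bij ?a" "bij ?b"
    using AB by (auto intro: glue_bij[OF R \<pi>(1)] glue_bij[OF R \<pi>(2)])
  have "?b (h x) = g (?b y)" if eq: "?a y = f (?a x)" for x y
  proof -
    let ?e = "R `` {x}"
    have e: "?e \<in> UNIV // R" "x \<in> ?e" using equiv_class_self[OF R UNIV_I] by (simp_all add: quotientI)
    have "?a x \<in> \<pi> ` ?e" using AB e by (meson bij_betwE)
    then have "?a y \<in> \<pi> ` ?e" using closed(2)[OF e(1)] eq by (simp add: cycle_closed_def)
    then have "?a y \<in> A ?e ` ?e" using AB e(1) by (simp add: bij_betw_def)
    then obtain z where z: "z \<in> ?e" "?a y = A ?e z" by blast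
    have cls_eq: "R `` {z} = ?e" if "z \<in> ?e" for z
      using that R by (metis Image_singleton_iff equiv_class_eq_iff)
    have "?a z = ?a y" using z cls_eq[OF z(1)] by simp
    then have "z = y" by (rule injD[OF bij_is_inj[OF bij(1)]])
    then have "y \<in> ?e" "R `` {y} = ?e" using z(1) cls_eq by auto
    moreover have "h x \<in> ?e" using closed(1)[OF e(1)] e(2) by (simp add: cycle_closed_def)
    then have "R `` {h x} = ?e" by (rule cls_eq)
    ultimately show ?thesis using AB e eq by simp
  qed
  then show ?thesis unfolding factors_def using bij by auto
qed

text \<open>
  Every point has countably many neighbours: each of the countably many injections in \<open>\<Lambda>\<close> contributes
  at most one outgoing and one incoming edge.
\<close>
lemma countable_components:
  assumes "countable \<Lambda>" and inj: "\<And>D l. (D, l) \<in> \<Lambda> \<Longrightarrow> inj_on l D"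
    and L: "L = {(x, l x) |x D l. (D, l) \<in> \<Lambda> \<and> x \<in> D}"
  shows "countable ((L \<union> L\<inverse>)\<^sup>* `` {x})"
proof (rule countable_rtrancl)
  show "countable ((L \<union> L\<inverse>) `` Y)" if "countable Y" for Y
  proof (rule countable_Image[OF _ that])
    fix y
    have "(L \<union> L\<inverse>) `` {y} \<subseteq> (\<lambda>(D, l). l y) ` \<Lambda> \<union> (\<lambda>(D, l). inv_into D l y) ` \<Lambda>"
    proof
      fix z assume "z \<in> (L \<union> L\<inverse>) `` {y}"
      then consider D l where "(D, l) \<in> \<Lambda>" "z = l y" | D l where "(D, l) \<in> \<Lambda>" "z \<in> D" "y = l z"
        unfolding L by blast
      then show "z \<in> (\<lambda>(D, l). l y) ` \<Lambda> \<union> (\<lambda>(D, l). inv_into D l y) ` \<Lambda>"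
      proof cases
        case 1
        then show ?thesis by force
      next
        case 2
        then have "z = inv_into D l y" using inj by simp
        then show ?thesis using 2(1) by force
      qed
    qed
    then show "countable ((L \<union> L\<inverse>) `` {y})"
      using \<open>countable \<Lambda>\<close> by (meson countable_Un countable_image countable_subset)
  qed
qed simp

lemma equiv_rtrancl_sym: "equiv UNIV ((L \<union> L\<inverse>)\<^sup>*)"
  by (intro equivI refl_rtrancl trans_rtrancl sym_rtrancl) (auto simp: sym_def)

text \<open>
  \<open>M\<close> is a common carrier: \<open>\<pi>\<close> and \<open>\<rho>\<close> move it onto sets that contain the supports of \<open>f\<close> and
  \<open>g\<close>.  The links make every component meet each of the sets that the countable case relies on, and
  the component of a point off \<open>M\<close> is that single point.
\<close>
lemma factors_UNIV:
  fixes f g h :: "'a \<Rightarrow> 'a"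
  assumes inj: "inj f" "inj g" "inj h" and \<pi>: "bij \<pi>" and \<rho>: "bij \<rho>"
    and supp: "support f \<subseteq> \<pi> ` M" "support g \<subseteq> \<rho> ` M" "support h \<subseteq> M"
    and card: "|M| \<le>o |Upsilon f|" "|M| \<le>o |Upsilon g|" "|M \<times> (UNIV :: nat set)| \<le>o |support h|"
    and defects: "|- range f| +c |- range g| =o |- range h|"
  shows "factors UNIV h UNIV f UNIV g"
proof -
  define \<pi>' where "\<pi>' = inv \<pi>"
  define \<rho>' where "\<rho>' = inv \<rho>"
  have \<pi>' [simp]: "\<pi>' (\<pi> x) = x" "\<pi> (\<pi>' x) = x" for x
    unfolding \<pi>'_def using \<pi> by (simp_all add: bij_def surj_f_inv_f)
  have \<rho>' [simp]: "\<rho>' (\<rho> x) = x" "\<rho> (\<rho>' x) = x" for x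
    unfolding \<rho>'_def using \<rho> by (simp_all add: bij_def surj_f_inv_f)
  have eqs: "\<pi> x = \<pi> y \<longleftrightarrow> x = y" "\<pi>' x = \<pi>' y \<longleftrightarrow> x = y" "\<rho> x = \<rho> y \<longleftrightarrow> x = y" "\<rho>' x = \<rho>' y \<longleftrightarrow> x = y"
    "f x = f y \<longleftrightarrow> x = y" "g x = g y \<longleftrightarrow> x = y" "h x = h y \<longleftrightarrow> x = y" for x y
    using inj by (metis \<pi>' \<rho>' injD)+
  obtain u where u: "inj_on u M" "u ` M \<subseteq> Upsilon f" using card(1) by (metis card_of_ordLeq)
  obtain v where v: "inj_on v M" "v ` M \<subseteq> Upsilon g" using card(2) by (metis card_of_ordLeq)
  obtain w :: "'a \<times> nat \<Rightarrow> 'a" where w: "inj_on w (M \<times> UNIV)" "w ` (M \<times> UNIV) \<subseteq> support h"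
    using card(3) by (metis card_of_ordLeq)
  have "|(- range f) <+> (- range g)| =o |- range h|"
    using defects by (simp add: csum_def Field_card_of)
  then obtain s where s: "bij_betw s ((- range f) <+> (- range g)) (- range h)"
    using card_of_ordIso by blast
  have s_eq: "s (Inl z) = s (Inl z') \<longleftrightarrow> z = z'" if "z \<notin> range f" "z' \<notin> range f" for z z'
    using inj_on_eq_iff[OF bij_betw_imp_inj_on[OF s], of "Inl z" "Inl z'"] that by (simp add: InlI)
  have s_eq': "s (Inr z) = s (Inr z') \<longleftrightarrow> z = z'" if "z \<notin> range g" "z' \<notin> range g" for z z'
    using inj_on_eq_iff[OF bij_betw_imp_inj_on[OF s], of "Inr z" "Inr z'"] that by (simp add: InrI)
  \<comment> \<open>\<open>\<Lambda>\<close> lists the links with their domains; all of them are injective and stay inside \<open>M\<close>.\<close>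
  define Df where "Df = {x \<in> M. \<pi> x \<notin> range f}"
  define Dg where "Dg = {x \<in> M. \<rho> x \<notin> range g}"
  define \<Lambda> where "\<Lambda> = {(M, \<lambda>x. \<pi>' (f (\<pi> x))), (M, \<lambda>x. \<rho>' (g (\<rho> x))), (M, h), (M, \<lambda>x. \<pi>' (u x)), (M, \<lambda>x. \<rho>' (v x)),
    (Df, \<lambda>x. s (Inl (\<pi> x))), (Dg, \<lambda>x. s (Inr (\<rho> x)))} \<union> range (\<lambda>n :: nat. (M, \<lambda>x. w (x, n)))"
  define L where "L = {(x, l x) |x D l. (D, l) \<in> \<Lambda> \<and> x \<in> D}"
  define R where "R = (L \<union> L\<inverse>)\<^sup>*"
  have equiv: "equiv UNIV R" unfolding R_def by (rule equiv_rtrancl_sym)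
  have link: "(x, l x) \<in> R" if "(D, l) \<in> \<Lambda>" "x \<in> D" for D l x
    using that unfolding R_def L_def by blast
  have inj_links: "inj_on l D" if "(D, l) \<in> \<Lambda>" for D l
    using that unfolding \<Lambda>_def
  proof (elim UnE insertE emptyE rangeE; clarsimp)
    show "inj_on (\<lambda>x. \<pi>' (f (\<pi> x))) M" "inj_on (\<lambda>x. \<rho>' (g (\<rho> x))) M" "inj_on h M"
      by (simp_all add: inj_on_def eqs)
    show "inj_on (\<lambda>x. \<pi>' (u x)) M" "inj_on (\<lambda>x. \<rho>' (v x)) M"
      using u(1) v(1) by (simp_all add: inj_on_def eqs)
    show "inj_on (\<lambda>x. s (Inl (\<pi> x))) Df" "inj_on (\<lambda>x. s (Inr (\<rho> x))) Dg"
      unfolding Df_def Dg_def by (auto simp: inj_on_def s_eq s_eq' eqs)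
    show "inj_on (\<lambda>x. w (x, n)) M" for n
      using w(1) by (auto simp: inj_on_def)
  qed
  have "countable \<Lambda>" unfolding \<Lambda>_def by simp
  then have countable: "countable (R `` {x})" for x
    unfolding R_def using inj_links L_def by (rule countable_components)
  have f_link: "(x, \<pi>' (f (\<pi> x))) \<in> R" and g_link: "(x, \<rho>' (g (\<rho> x))) \<in> R"
    and h_link: "(x, h x) \<in> R" and u_link: "(x, \<pi>' (u x)) \<in> R" and v_link: "(x, \<rho>' (v x)) \<in> R"
    and w_link: "(x, w (x, n)) \<in> R" if "x \<in> M" for x n
    using link[of M "\<lambda>x. \<pi>' (f (\<pi> x))" x] link[of M "\<lambda>x. \<rho>' (g (\<rho> x))" x] link[of M h x]
      link[of M "\<lambda>x. \<pi>' (u x)" x] link[of M "\<lambda>x. \<rho>' (v x)" x] link[of M "\<lambda>x. w (x, n)" x] that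
    by (simp_all add: \<Lambda>_def)
  have Df_link: "(x, s (Inl (\<pi> x))) \<in> R" if "x \<in> M" "\<pi> x \<notin> range f" for x
    by (rule link[of Df "\<lambda>x. s (Inl (\<pi> x))"]) (use that in \<open>simp_all add: \<Lambda>_def Df_def\<close>)
  have Dg_link: "(x, s (Inr (\<rho> x))) \<in> R" if "x \<in> M" "\<rho> x \<notin> range g" for x
    by (rule link[of Dg "\<lambda>x. s (Inr (\<rho> x))"]) (use that in \<open>simp_all add: \<Lambda>_def Dg_def\<close>)
  have fixed: "f (\<pi> x) = \<pi> x" "g (\<rho> x) = \<rho> x" "h x = x" if "x \<notin> M" for x
  proof -
    have "\<pi> x \<notin> \<pi> ` M" "\<rho> x \<notin> \<rho> ` M" using that by (simp_all add: image_iff eqs)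
    then have "\<pi> x \<notin> support f" "\<rho> x \<notin> support g" "x \<notin> support h" using supp that by blast+
    then show "f (\<pi> x) = \<pi> x" "g (\<rho> x) = \<rho> x" "h x = x" by (simp_all add: support_def)
  qed
  have refl: "(x, x) \<in> R" for x unfolding R_def by simp
  have step: "(x, \<pi>' (f (\<pi> x))) \<in> R" "(x, \<rho>' (g (\<rho> x))) \<in> R" "(x, h x) \<in> R" for x
    using f_link[of x] g_link[of x] h_link[of x] fixed[of x] refl[of x] by (cases "x \<in> M"; simp)+
  show ?thesis
  proof (rule factors_glue[OF equiv \<pi> \<rho>])
    fix e assume e: "e \<in> UNIV // R"
    have R_iff: "x \<in> e \<longleftrightarrow> y \<in> e" if "(x, y) \<in> R" for x y
      using that e equiv by (metis in_quotient_imp_closed equivE symD)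
    have mem: "\<pi> x \<in> \<pi> ` e \<longleftrightarrow> x \<in> e" "\<rho> x \<in> \<rho> ` e \<longleftrightarrow> x \<in> e" for x using eqs by auto
    show h_closed: "cycle_closed h e" unfolding cycle_closed_def using R_iff step(3) by blast
    show f_closed: "cycle_closed f (\<pi> ` e)"
      unfolding cycle_closed_def using R_iff[OF step(1)] mem(1) by (metis \<pi>'(2))
    have g_closed: "cycle_closed g (\<rho> ` e)"
      unfolding cycle_closed_def using R_iff[OF step(2)] mem(2) by (metis \<rho>'(2))
    show "factors e h (\<pi> ` e) f (\<rho> ` e) g"
    proof (cases "e \<inter> M = {}")
      case True
      have "bij_betw \<pi> e (\<pi> ` e)" "bij_betw \<rho> e (\<rho> ` e)" by (auto simp: bij_betw_def inj_on_def eqs)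
      moreover have "\<rho> (h x) = g (\<rho> y)" if "x \<in> e" "y \<in> e" "\<pi> y = f (\<pi> x)" for x y
      proof -
        have "x \<notin> M" using True that(1) by blast
        then show ?thesis using fixed[of x] that(3) by (simp add: eqs)
      qed
      ultimately show ?thesis unfolding factors_def by blast
    next
      case False
      then obtain x0 where x0: "x0 \<in> e" "x0 \<in> M" by blast
      have e_eq: "e = R `` {x0}" using e x0(1) equiv by (metis Image_singleton_iff equiv_class_eq_iff quotientE)
      \<comment> \<open>The links from a single point \<open>x0\<close> of the component provide all that the countable case needs.\<close>
      have inf: "infinite (e \<inter> support h)"
      proof (rule infinite_super)
        show "range (\<lambda>n. w (x0, n)) \<subseteq> e \<inter> support h"
        proof (rule image_subsetI)
          fix n
          have "w (x0, n) \<in> support h" using w(2) x0(2) by auto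
          then show "w (x0, n) \<in> e \<inter> support h" using R_iff[OF w_link[OF x0(2)]] x0(1) by simp
        qed
        show "infinite (range (\<lambda>n. w (x0, n)))"
          using w(1) x0(2) by (intro range_inj_infinite) (auto simp: inj_on_def)
      qed
      have "\<pi>' (u x0) \<in> e" "\<rho>' (v x0) \<in> e"
        using R_iff[OF u_link[OF x0(2)]] R_iff[OF v_link[OF x0(2)]] x0(1) by simp_all
      then have "u x0 \<in> \<pi> ` e" "v x0 \<in> \<rho> ` e" using mem by (metis \<pi>'(2), metis \<rho>'(2))
      moreover have "u x0 \<in> Upsilon f" "v x0 \<in> Upsilon g" using u(2) v(2) x0(2) by auto
      ultimately obtain P Q where P: "infinite_chain f P" "P \<subseteq> \<pi> ` e" and Q: "infinite_chain g Q" "Q \<subseteq> \<rho> ` e"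
        using Upsilon_closed_chain[OF inj(1) f_closed] Upsilon_closed_chain[OF inj(2) g_closed] by metis
      have "|\<pi> ` e - range f| +c |\<rho> ` e - range g| =o |e - range h|"
      proof -
        let ?D = "(\<pi> ` e - range f) <+> (\<rho> ` e - range g)"
        \<comment> \<open>As partners are linked, the bijection of the defects respects the component.\<close>
        have in_e: "s a \<in> e \<longleftrightarrow> a \<in> \<pi> ` e <+> \<rho> ` e" if a: "a \<in> (- range f) <+> (- range g)" for a
          using a
        proof
          fix z assume z: "z \<in> - range f" "a = Inl z"
          have "\<pi>' z \<in> M" using fixed(1)[of "\<pi>' z"] z(1) by (metis ComplD \<pi>'(2) rangeI)
          then have "(\<pi>' z, s (Inl (\<pi> (\<pi>' z)))) \<in> R"
            using z(1) by (intro Df_link) auto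
          then show ?thesis using R_iff z(2) mem(1)[of "\<pi>' z"] by auto
        next
          fix z assume z: "z \<in> - range g" "a = Inr z"
          have "\<rho>' z \<in> M" using fixed(2)[of "\<rho>' z"] z(1) by (metis ComplD \<rho>'(2) rangeI)
          then have "(\<rho>' z, s (Inr (\<rho> (\<rho>' z)))) \<in> R"
            using z(1) by (intro Dg_link) auto
          then show ?thesis using R_iff z(2) mem(2)[of "\<rho>' z"] by auto
        qed
        have "bij_betw s ?D (s ` ?D)"
          using s by (rule bij_betw_subset) auto
        moreover have "s ` ?D = e - range h"
        proof
          show "s ` ?D \<subseteq> e - range h" using in_e s by (auto simp: bij_betw_def)
          show "e - range h \<subseteq> s ` ?D"
          proof
            fix y assume y: "y \<in> e - range h"
            then have "y \<in> s ` ((- range f) <+> (- range g))" using s by (simp add: bij_betw_def)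
            then obtain a where a: "a \<in> (- range f) <+> (- range g)" "y = s a" by blast
            then have "a \<in> ?D" using in_e[OF a(1)] y by auto
            then show "y \<in> s ` ?D" using a(2) by blast
          qed
        qed
        ultimately have "|?D| =o |e - range h|" by (metis card_of_ordIsoI)
        then show ?thesis by (simp add: csum_def Field_card_of)
      qed
      moreover have "countable e" unfolding e_eq by (rule countable)
      ultimately show ?thesis
        using factors_countable[OF inj _ h_closed inf _ f_closed P _ g_closed Q] by simp
    qed
  qed
qed

section \<open>Cardinalities and the theorem\<close>

lemma card_of_disjoint_Un:
  assumes "A \<inter> B = {}"
  shows "|A| +c |B| =o |A \<union> B|"
proof -
  have "inj_on (case_sum id id) (A <+> B)"
    using assms by (intro inj_onI) (elim PlusE; auto)
  moreover have "case_sum id id ` (A <+> B) = A \<union> B"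
    unfolding Plus_def image_Un image_image by simp
  ultimately have "|A <+> B| =o |A \<union> B|"
    by (intro card_of_ordIsoI[of "case_sum id id"]) (simp add: bij_betw_def)
  then show ?thesis by (simp add: csum_def Field_card_of)
qed

lemma card_of_Compl_range_conjugate:
  assumes "bij a"
  shows "|- range (inv a \<circ> f \<circ> a)| =o |- range f|"
proof -
  have "range (inv a \<circ> f \<circ> a) = inv a ` range f"
    using bij_is_surj[OF assms] by (simp add: image_comp[symmetric] del: image_comp o_apply)
  then have "inv a ` (- range f) = - range (inv a \<circ> f \<circ> a)"
    using bij_image_Compl_eq[OF bij_imp_bij_inv[OF assms], of "range f"] by simp
  moreover have "inj_on (inv a) (- range f)"
    using bij_is_inj[OF bij_imp_bij_inv[OF assms]] by (rule inj_on_subset) simp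
  ultimately have "|- range f| =o |- range (inv a \<circ> f \<circ> a)|"
    by (intro card_of_ordIsoI[of "inv a"]) (simp add: bij_betw_def)
  then show ?thesis by (rule ordIso_symmetric)
qed

text \<open>
  What \<open>g \<circ> f\<close> misses is what \<open>g\<close> misses, together with the images under \<open>g\<close> of what \<open>f\<close> misses.
\<close>
lemma card_of_Compl_range_comp:
  assumes "inj g"
  shows "|- range f| +c |- range g| =o |- range (g \<circ> f)|"
proof -
  have split: "- range (g \<circ> f) = g ` (- range f) \<union> - range g"
  proof (rule set_eqI)
    fix y
    show "y \<in> - range (g \<circ> f) \<longleftrightarrow> y \<in> g ` (- range f) \<union> - range g"
    proof (cases "y \<in> range g")
      case True
      then obtain x where "y = g x" by blast
      then show ?thesis using assms by (simp add: image_iff inj_eq)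
    next
      case False
      then have "y \<notin> range (g \<circ> f)" by auto
      then show ?thesis using False by simp
    qed
  qed
  have "|- range f| =o |g ` (- range f)|"
    using card_of_image_inj[OF assms refl] .
  then have "|- range f| +c |- range g| =o |g ` (- range f)| +c |- range g|"
    by (rule csum_cong1)
  also have "|g ` (- range f)| +c |- range g| =o |- range (g \<circ> f)|"
    unfolding split by (rule card_of_disjoint_Un) auto
  finally show ?thesis .
qed

text \<open>
  A union of two smaller sets cannot exhaust an infinite set.
\<close>
lemma card_of_Compl_infinite:
  fixes B :: "'a set"
  assumes "infinite (UNIV :: 'a set)" and "|B| <o |UNIV :: 'a set|"
  shows "|- B| =o |UNIV :: 'a set|"
proof -
  have "\<not> |- B| <o |UNIV :: 'a set|"
  proof
    assume "|- B| <o |UNIV :: 'a set|"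
    then have "|B <+> - B| <o |UNIV :: 'a set|"
      using card_of_Plus_ordLess_infinite[OF assms] by blast
    moreover have "|UNIV :: 'a set| \<le>o |B <+> - B|"
      using card_of_Un_Plus_ordLeq[of B "- B"] by simp
    ultimately show False using not_ordLess_ordLeq by blast
  qed
  moreover have "|- B| \<le>o |UNIV :: 'a set|" by (rule card_of_mono1) simp
  ultimately show ?thesis using ordLeq_iff_ordLess_or_ordIso by blast
qed

lemma bij_of_equipotent:
  assumes "|A| =o |B|" "|- A| =o |- B|"
  obtains \<pi> where "bij \<pi>" "\<pi> ` A = B"
proof -
  obtain p where p: "bij_betw p A B" using assms(1) card_of_ordIso by blast
  obtain q where q: "bij_betw q (- A) (- B)" using assms(2) card_of_ordIso by blast
  let ?\<pi> = "\<lambda>x. if x \<in> A then p x else q x"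
  have 1: "bij_betw ?\<pi> A B" using p by (subst bij_betw_cong[where g = p]) auto
  moreover have "bij_betw ?\<pi> (- A) (- B)" using q by (subst bij_betw_cong[where g = q]) auto
  ultimately have "bij_betw ?\<pi> (A \<union> - A) (B \<union> - B)" by (rule bij_betw_combine) simp
  then have "bij ?\<pi>" by simp
  moreover have "?\<pi> ` A = B" using 1 by (rule bij_betw_imp_surj_on)
  ultimately show ?thesis by (rule that)
qed

text \<open>
  If \<open>C\<close> is as large as the whole type, take everything.  Otherwise the complements of \<open>A\<close>, \<open>B\<close> and
  \<open>C\<close> all have the cardinality of the type, so permutations move \<open>C\<close> onto \<open>A\<close> and onto \<open>B\<close>.
\<close>
lemma common_carrier:
  fixes A B C :: "'a set"
  assumes "infinite (UNIV :: 'a set)" and "|A| =o |C|" "|B| =o |C|"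
  obtains M and \<pi> \<rho> :: "'a \<Rightarrow> 'a" where "bij \<pi>" "bij \<rho>" "A \<subseteq> \<pi> ` M" "B \<subseteq> \<rho> ` M" "C \<subseteq> M" "|M| =o |C|"
proof (cases "|C| =o |UNIV :: 'a set|")
  case True
  show ?thesis
    by (rule that[of id id UNIV]) (use ordIso_symmetric[OF True] in auto)
next
  case False
  then have C: "|C| <o |UNIV :: 'a set|" using card_of_mono1[OF subset_UNIV, of C] ordLeq_iff_ordLess_or_ordIso by blast
  have small: "|- D| =o |UNIV :: 'a set|" if "|D| =o |C|" for D :: "'a set"
    using card_of_Compl_infinite[OF assms(1) ordIso_ordLess_trans[OF that C]] .
  have bij: "\<exists>\<pi>. bij \<pi> \<and> \<pi> ` C = D" if "|D| =o |C|" for D :: "'a set"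
  proof -
    have "|- C| =o |- D|"
      using small[OF that] small[of C] by (meson card_of_refl ordIso_symmetric ordIso_transitive)
    then show ?thesis using bij_of_equipotent[of C D] ordIso_symmetric[OF that] by blast
  qed
  obtain \<pi> where "bij \<pi>" "\<pi> ` C = A" using bij[OF assms(2)] by blast
  moreover obtain \<rho> where "bij \<rho>" "\<rho> ` C = B" using bij[OF assms(3)] by blast
  ultimately show ?thesis using that[of \<pi> \<rho> C] card_of_refl by blast
qed

theorem corollary13:
  fixes f g h :: "'a \<Rightarrow> 'a" and K :: "'k rel"
  assumes "infinite (UNIV :: 'a set)"
    and "inj f" and "inj g" and "inj h"
    and "Card_order K" and "natLeq \<le>o K" and "K \<le>o |UNIV :: 'a set|"
    and "|support f| =o K" and "|support g| =o K" and "|support h| =o K"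
    and "|Upsilon f| =o K" and "|Upsilon g| =o K"
  shows "(\<exists>a b. bij a \<and> bij b \<and> h = a \<circ>> f \<circ>> inv a \<circ>> b \<circ>> g \<circ>> inv b) \<longleftrightarrow>
         |UNIV - range f| +c |UNIV - range g| =o |UNIV - range h|"
proof
  assume "\<exists>a b. bij a \<and> bij b \<and> h = a \<circ>> f \<circ>> inv a \<circ>> b \<circ>> g \<circ>> inv b"
  then obtain a b where ab: "bij a" "bij b" and h: "h = a \<circ>> f \<circ>> inv a \<circ>> b \<circ>> g \<circ>> inv b" by blast
  let ?f = "inv a \<circ> f \<circ> a" and ?g = "inv b \<circ> g \<circ> b"
  have h_eq: "h = ?g \<circ> ?f" unfolding h by (simp add: fun_eq_iff)
  have "inj ?g"
    using inj_compose[OF inj_compose[OF bij_is_inj[OF bij_imp_bij_inv[OF ab(2)]] \<open>inj g\<close>]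
        bij_is_inj[OF ab(2)]] .
  then have "|- range ?f| +c |- range ?g| =o |- range h|"
    unfolding h_eq by (rule card_of_Compl_range_comp)
  moreover have "|- range f| +c |- range g| =o |- range ?f| +c |- range ?g|"
    using ab by (intro csum_cong ordIso_symmetric[OF card_of_Compl_range_conjugate])
  ultimately show "|UNIV - range f| +c |UNIV - range g| =o |UNIV - range h|"
    unfolding Compl_eq_Diff_UNIV[symmetric] by (rule ordIso_transitive[rotated])
next
  assume defects: "|UNIV - range f| +c |UNIV - range g| =o |UNIV - range h|"
  have supp: "|support f| =o |support h|" "|support g| =o |support h|"
    using assms(8-10) by (meson ordIso_symmetric ordIso_transitive)+
  obtain M \<pi> \<rho> where "bij \<pi>" "bij \<rho>" "support f \<subseteq> \<pi> ` M" "support g \<subseteq> \<rho> ` M" "support h \<subseteq> M"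
    and M: "|M| =o |support h|"
    using common_carrier[OF assms(1) supp] .
  have MK: "|M| =o K" using M assms(10) by (rule ordIso_transitive)
  have "natLeq \<le>o |M|" using assms(6) ordIso_symmetric[OF MK] by (rule ordLeq_ordIso_trans)
  then have "infinite M" using infinite_iff_natLeq_ordLeq by blast
  have "|M| \<le>o |Upsilon f|" "|M| \<le>o |Upsilon g|"
    using ordIso_transitive[OF MK ordIso_symmetric[OF assms(11)]]
      ordIso_transitive[OF MK ordIso_symmetric[OF assms(12)]] ordIso_iff_ordLeq by blast+
  moreover have "|M \<times> (UNIV :: nat set)| \<le>o |support h|"
  proof -
    have "|UNIV :: nat set| \<le>o |M|" using \<open>infinite M\<close> infinite_iff_card_of_nat by blast
    then have "|M \<times> (UNIV :: nat set)| =o |M|"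
      using card_of_Times_infinite[OF \<open>infinite M\<close>] by blast
    then show ?thesis using ordIso_transitive[OF _ M] ordIso_iff_ordLeq by blast
  qed
  ultimately have "factors UNIV h UNIV f UNIV g"
    using defects unfolding Compl_eq_Diff_UNIV[symmetric]
    by (rule factors_UNIV[OF assms(2-4) \<open>bij \<pi>\<close> \<open>bij \<rho>\<close> \<open>support f \<subseteq> \<pi> ` M\<close>
          \<open>support g \<subseteq> \<rho> ` M\<close> \<open>support h \<subseteq> M\<close>])
  then obtain a b where a: "bij a" and b: "bij b"
    and ab: "\<And>x y. a y = f (a x) \<Longrightarrow> b (h x) = g (b y)"
    unfolding factors_def by auto
  have "h x = (a \<circ>> f \<circ>> inv a \<circ>> b \<circ>> g \<circ>> inv b) x" for x
  proof -
    have "a (inv a (f (a x))) = f (a x)" using a by (simp add: bij_is_surj surj_f_inv_f)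
    then have "b (h x) = g (b (inv a (f (a x))))" by (rule ab)
    then have "h x = inv b (g (b (inv a (f (a x)))))" using b by (metis bij_inv_eq_iff)
    then show ?thesis by simp
  qed
  then show "\<exists>a b. bij a \<and> bij b \<and> h = a \<circ>> f \<circ>> inv a \<circ>> b \<circ>> g \<circ>> inv b"
    using a b by blast
qed

end
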